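(* Let $p\ge 1$ be an integer. A LIRK-W method of type 1 with $s$ stages and real coefficients $a_{i,j},\gamma_{i,j},b_i,g_i$ has order $p$ if and only if $$\sum_{j=1}^s \Phi^1_j(\tau)=\frac{1}{\gamma(\tau)}\qquad\text{for all } \tau\in T \text{ with } \rho(\tau)\le p,$$ and $$\sum_{j=1}^s \Phi^1_j(\tau)=0\qquad\text{for all } \tau\in LW_1\setminus T \text{ with } \rho(\tau)\le p.$$
   Context: **Problem.** Consider the autonomous initial value problem $y'=F(y)$, $y(t_n)=y_n$, with $F:\mathbb{R}^N\to\mathbb{R}^N$ smooth, and let $t\mapsto \mathbf{L}(t)\in\mathbb{R}^{N\times N}$ be an arbitrary smooth time-dependent matrix. **Method.** Coefficients are real numbers $a_{i,j}$ ($1\le j<i\le s$), $\gamma_{i,j}$ ($1\le j\le i\le s$), $b_i,g_i$ ($1\le i\le s$), with $a_{i,j}=0$ for $j\ge i$ and $\gamma_{i,j}=0$ for $j>i$. One step of size $h$ of the LIRK-W (linearly-implicit Runge-Kutta-W) method of type 1 is $$Y_i=y_n+h\sum_{j=1}^{i-1}a_{i,j}F(Y_j)+h\sum_{j=1}^{i}\gamma_{i,j}\mathbf{L}_jY_j\quad(i=1,\dots,s),$$ $$y_{n+1}=y_n+h\sum_{i=1}^s b_iF(Y_i)+h\sum_{i=1}^s g_i\mathbf{L}_iY_i,\qquad \mathbf{L}_i=\mathbf{L}(t_n+h\gamma_{i,i}).$$ (For $h$ small the stages are well defined.) The method has order $p$ if, for every $N$, every smooth $F$, every smooth $\mathbf{L}(\cdot)$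 and every $t_n,y_n$, the Taylor expansions in $h$ at $h=0$ of $y_{n+1}$ and of the exact solution $y(t_n+h)$ agree up to and including the $h^p$ terms, i.e. $y_{n+1}-y(t_n+h)=O(h^{p+1})$. **Trees.** Consider finite nonempty rooted trees (unordered, up to isomorphism) whose vertices are each of one of three kinds: meagre, fat, or square. $LW_1$ is the set of such trees in which every fat vertex has at most one child, and every square vertex has exactly one child, which is square or fat; meagre vertices may have any number of children of any kind. $T\subset LW_1$ is the set of trees all of whose vertices are meagre. Notation: $[\,]_\bullet$ is the single meagre vertex and $[\tau_1,\dots,\tau_m]_\bullet$ is the tree obtained by attaching $\tau_1,\dots,\tau_m$ to a meagre root; $[\,]_\circ$ is the single fat vertex and $[\tau_1]_\circ$ attaches $\tau_1$ to a fat root; for $q\ge1$, $[\tau_1]_{\theta_q}$ (resp. $[\,]_{\theta_q}$) is the tree consisting of a chain of $q$ square vertices starting at the root, followed by a fat vertex, to which $\tau_1$ (resp. nothing) is attached. Every tree in $LW_1$ has exactly one of these forms with subtrees in $LW_1$. $\rho(\tau)$ is the number of vertices of $\tau$ (all kinds counted). For $\tau\in T$, $\gamma(\tau)$ is defined by $\gamma([\,]_\bullet)=1$ and $\gamma([\tau_1,\dots,\tau_m]_\bullet)=\rho(\tau)\gamma(\tau_1)\cdots\gamma(\tau_m)$ (not to be confused with the coefficients $\gamma_{i,j}$). **Elementary weights** (all sums over $k$ from $1$ to $s$): - $\Phi^1_j([\,]_\bullet)=b_j$; $\ \Phi^1_j([\tau_1,\dots,\tau_m]_\bullet)=b_j\,\bar\Phi^1_j(\tau_1)\cdots\bar\Phi^1_j(\tau_m)$;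 - $\Phi^1_j([\,]_\circ)=g_j$; $\ \Phi^1_j([\tau_1]_\circ)=g_j\,\bar\Phi^1_j(\tau_1)$; - $\Phi^1_j([\,]_{\theta_q})=g_j\gamma_{j,j}^q$; $\ \Phi^1_j([\tau_1]_{\theta_q})=g_j\gamma_{j,j}^q\,\bar\Phi^1_j(\tau_1)$; - $\bar\Phi^1_j([\,]_\bullet)=\sum_k a_{j,k}$; $\ \bar\Phi^1_j([\tau_1,\dots,\tau_m]_\bullet)=\sum_k a_{j,k}\,\bar\Phi^1_k(\tau_1)\cdots\bar\Phi^1_k(\tau_m)$; - $\bar\Phi^1_j([\,]_\circ)=\sum_k\gamma_{j,k}$; $\ \bar\Phi^1_j([\tau_1]_\circ)=\sum_k\gamma_{j,k}\,\bar\Phi^1_k(\tau_1)$; - $\bar\Phi^1_j([\,]_{\theta_q})=\sum_k\gamma_{j,k}\gamma_{k,k}^q$; $\ \bar\Phi^1_j([\tau_1]_{\theta_q})=\sum_k\gamma_{j,k}\gamma_{k,k}^q\,\bar\Phi^1_k(\tau_1)$. *)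

theory Defs
  imports "HOL-Analysis.Analysis" "HOL-Library.Landau_Symbols"
begin

section \<open>Euclidean spaces of varying dimension and smooth data\<close>

text \<open>
  The order of a method quantifies over all dimensions, so \<open>\<real>\<^sup>N\<close> is the library's
  \<^const>\<open>Euclidean_space\<close>: functions \<open>nat \<Rightarrow> real\<close> whose coordinates with index \<open>\<ge> N\<close> vanish
  (coordinates are numbered from 0).
\<close>

definition RN :: "nat \<Rightarrow> (nat \<Rightarrow> real) set" where
  "RN N = topspace (Euclidean_space N)"

definition partial :: "nat \<Rightarrow> ((nat \<Rightarrow> real) \<Rightarrow> real) \<Rightarrow> (nat \<Rightarrow> real) \<Rightarrow> real" where
  "partial i f x = deriv (\<lambda>t. f (x(i := t))) (x i)"

text \<open>\<open>C\<^sup>\<infinity>\<close>: the iterated partial derivatives of all orders exist everywhere and are continuous.\<close>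

definition smooth_fun :: "nat \<Rightarrow> ((nat \<Rightarrow> real) \<Rightarrow> real) \<Rightarrow> bool" where
  "smooth_fun N f \<longleftrightarrow>
     (\<forall>is. set is \<subseteq> {..<N} \<longrightarrow>
        continuous_map (Euclidean_space N) euclideanreal (foldr partial is f) \<and>
        (\<forall>i<N. \<forall>x\<in>RN N. (\<lambda>t. foldr partial is f (x(i := t))) field_differentiable at (x i)))"

definition smooth_field :: "nat \<Rightarrow> ((nat \<Rightarrow> real) \<Rightarrow> nat \<Rightarrow> real) \<Rightarrow> bool" where
  "smooth_field N F \<longleftrightarrow> F \<in> RN N \<rightarrow> RN N \<and> (\<forall>k<N. smooth_fun N (\<lambda>x. F x k))"

text \<open>
  An \<open>N \<times> N\<close> matrix is given by its entries \<open>A k l\<close> with \<open>k, l < N\<close>; entries outside this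
  range are never used.
\<close>

definition mat_vec :: "nat \<Rightarrow> (nat \<Rightarrow> nat \<Rightarrow> real) \<Rightarrow> (nat \<Rightarrow> real) \<Rightarrow> nat \<Rightarrow> real" where
  "mat_vec N A x = (\<lambda>k. if k < N then (\<Sum>l<N. A k l * x l) else 0)"

definition smooth_matrix :: "nat \<Rightarrow> (real \<Rightarrow> nat \<Rightarrow> nat \<Rightarrow> real) \<Rightarrow> bool" where
  "smooth_matrix N L \<longleftrightarrow>
     (\<forall>k<N. \<forall>l<N. \<forall>m t. (deriv ^^ m) (\<lambda>t. L t k l) field_differentiable at t)"


section \<open>LIRK-W methods of type 1\<close>

text \<open>
  Stages are numbered \<open>1, \<dots>, s\<close>. The relation says that \<open>y1\<close> is the result of one step of
  size \<open>h\<close> from \<open>yn\<close> at time \<open>tn\<close>, for some solution \<open>Y\<close> of the (implicit) stage equations.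
\<close>

definition lirkw1_step ::
  "nat \<Rightarrow> (nat \<Rightarrow> nat \<Rightarrow> real) \<Rightarrow> (nat \<Rightarrow> nat \<Rightarrow> real) \<Rightarrow> (nat \<Rightarrow> real) \<Rightarrow> (nat \<Rightarrow> real) \<Rightarrow>
   nat \<Rightarrow> ((nat \<Rightarrow> real) \<Rightarrow> nat \<Rightarrow> real) \<Rightarrow> (real \<Rightarrow> nat \<Rightarrow> nat \<Rightarrow> real) \<Rightarrow>
   real \<Rightarrow> (nat \<Rightarrow> real) \<Rightarrow> real \<Rightarrow> (nat \<Rightarrow> real) \<Rightarrow> bool" where
  "lirkw1_step s a \<gamma> b g N F L tn yn h y1 \<longleftrightarrow>
     (\<exists>Y :: nat \<Rightarrow> nat \<Rightarrow> real.
        (\<forall>i\<in>{1..s}. Y i \<in> RN N) \<and>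
        (\<forall>i\<in>{1..s}. \<forall>k.
           Y i k = yn k + h * (\<Sum>j=1..<i. a i j * F (Y j) k)
                   + h * (\<Sum>j=1..i. \<gamma> i j * mat_vec N (L (tn + h * \<gamma> j j)) (Y j) k)) \<and>
        (\<forall>k. y1 k = yn k + h * (\<Sum>i=1..s. b i * F (Y i) k)
                   + h * (\<Sum>i=1..s. g i * mat_vec N (L (tn + h * \<gamma> i i)) (Y i) k)))"

definition local_solution ::
  "nat \<Rightarrow> ((nat \<Rightarrow> real) \<Rightarrow> nat \<Rightarrow> real) \<Rightarrow> real \<Rightarrow> (nat \<Rightarrow> real) \<Rightarrow> (real \<Rightarrow> nat \<Rightarrow> real) \<Rightarrow> bool" where
  "local_solution N F tn yn y \<longleftrightarrow>
     y tn = yn \<and>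
     (\<forall>\<^sub>F t in nhds tn. y t \<in> RN N \<and>
        (\<forall>k<N. ((\<lambda>t. y t k) has_real_derivative F (y t) k) (at t)))"

text \<open>
  For smooth data the step is uniquely determined for all sufficiently small \<open>\<bar>h\<bar>\<close> and the
  exact solution is locally unique, so quantifying over all \<open>\<eta>\<close> and \<open>y\<close> amounts to taking
  the numerical approximation \<open>h \<mapsto> y\<^sub>n\<^sub>+\<^sub>1\<close> and the solution of the initial value problem.
\<close>

definition lirkw1_order ::
  "nat \<Rightarrow> (nat \<Rightarrow> nat \<Rightarrow> real) \<Rightarrow> (nat \<Rightarrow> nat \<Rightarrow> real) \<Rightarrow> (nat \<Rightarrow> real) \<Rightarrow> (nat \<Rightarrow> real) \<Rightarrow>
   nat \<Rightarrow> bool" where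
  "lirkw1_order s a \<gamma> b g p \<longleftrightarrow>
     (\<forall>N F L tn yn y \<eta>.
        smooth_field N F \<longrightarrow> smooth_matrix N L \<longrightarrow> yn \<in> RN N \<longrightarrow>
        local_solution N F tn yn y \<longrightarrow>
        (\<forall>\<^sub>F h in at 0. lirkw1_step s a \<gamma> b g N F L tn yn h (\<eta> h)) \<longrightarrow>
        (\<forall>k<N. (\<lambda>h. \<eta> h k - y (tn + h) k) \<in> O[at 0](\<lambda>h. h ^ (p + 1))))"


section \<open>Trees\<close>

datatype kind = Meagre | Fat | Square

text \<open>Multisets of subtrees make the trees unordered, i.e. isomorphic trees are equal.\<close>

datatype ltree = Vertex (root_kind: kind) (subtrees: "ltree multiset")

inductive_set LW1 :: "ltree set" where
  "(\<And>\<tau>. \<tau> \<in># ts \<Longrightarrow> \<tau> \<in> LW1) \<Longrightarrow> Vertex Meagre ts \<in> LW1"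
| "size ts \<le> 1 \<Longrightarrow> (\<And>\<tau>. \<tau> \<in># ts \<Longrightarrow> \<tau> \<in> LW1) \<Longrightarrow> Vertex Fat ts \<in> LW1"
| "root_kind \<tau> \<in> {Square, Fat} \<Longrightarrow> \<tau> \<in> LW1 \<Longrightarrow> Vertex Square {#\<tau>#} \<in> LW1"

inductive_set T :: "ltree set" where
  "(\<And>\<tau>. \<tau> \<in># ts \<Longrightarrow> \<tau> \<in> T) \<Longrightarrow> Vertex Meagre ts \<in> T"

primrec \<rho> :: "ltree \<Rightarrow> nat" where
  "\<rho> (Vertex c ts) = 1 + \<Sum>\<^sub># (image_mset \<rho> ts)"

text \<open>The tree_density \<open>\<gamma>(\<tau>)\<close>; it is only meaningful on \<^const>\<open>T\<close>.\<close>

primrec tree_density :: "ltree \<Rightarrow> nat" where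
  "tree_density (Vertex c ts) = \<rho> (Vertex c ts) * \<Prod>\<^sub># (image_mset tree_density ts)"

text \<open>
  \<open>\<theta> q {#}\<close> and \<open>\<theta> q {#\<tau>#}\<close> are \<open>[]\<^bsub>\<theta>\<^sub>q\<^esub>\<close> and \<open>[\<tau>]\<^bsub>\<theta>\<^sub>q\<^esub>\<close>; for \<open>q = 0\<close> these are the trees
  with a fat root.
\<close>

definition \<theta> :: "nat \<Rightarrow> ltree multiset \<Rightarrow> ltree" where
  "\<theta> q ts = ((\<lambda>\<tau>. Vertex Square {#\<tau>#}) ^^ q) (Vertex Fat ts)"

lemma \<theta>_0: "\<theta> 0 ts = Vertex Fat ts"
  and \<theta>_Suc: "\<theta> (Suc q) ts = Vertex Square {#\<theta> q ts#}"
  by (simp_all add: \<theta>_def)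

lemma \<theta>_not_Meagre: "\<theta> q ts \<noteq> Vertex Meagre us"
  by (cases q) (simp_all add: \<theta>_0 \<theta>_Suc)

lemma \<theta>_inject: "\<theta> q ts = \<theta> r us \<longleftrightarrow> q = r \<and> ts = us"
proof (induction q arbitrary: r)
  case 0
  then show ?case by (cases r) (auto simp: \<theta>_0 \<theta>_Suc)
next
  case (Suc q)
  then show ?case by (cases r) (auto simp: \<theta>_0 \<theta>_Suc)
qed

lemma size_subtree: "\<tau> \<in># ts \<Longrightarrow> size \<tau> < size (Vertex c ts)"
  by (induction ts) (auto simp: less_Suc_eq_le)

lemma size_subtree_\<theta>: "\<tau> \<in># ts \<Longrightarrow> size \<tau> < size (\<theta> q ts)"
proof (induction q)
  case 0
  then show ?case by (simp add: \<theta>_0 size_subtree del: ltree.size)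
next
  case (Suc q)
  have "size (\<theta> q ts) < size (\<theta> (Suc q) ts)"
    unfolding \<theta>_Suc by (rule size_subtree) simp
  with Suc show ?case by simp
qed

text \<open>The forms used in the recursion for the elementary weights exhaust \<^const>\<open>LW1\<close>.\<close>

lemma LW1_cases:
  assumes "\<tau> \<in> LW1"
  obtains (Meagre) ts where "\<tau> = Vertex Meagre ts" "set_mset ts \<subseteq> LW1"
    | (theta_leaf) q where "\<tau> = \<theta> q {#}"
    | (theta) q \<tau>1 where "\<tau> = \<theta> q {#\<tau>1#}" "\<tau>1 \<in> LW1"
proof -
  have "(\<exists>ts. \<tau> = Vertex Meagre ts \<and> set_mset ts \<subseteq> LW1) \<or> (\<exists>q. \<tau> = \<theta> q {#}) \<or>
        (\<exists>q \<tau>1. \<tau> = \<theta> q {#\<tau>1#} \<and> \<tau>1 \<in> LW1)"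
    using assms
  proof induction
    case (1 ts)
    then show ?case by auto
  next
    case (2 ts)
    then have "ts = {#} \<or> (\<exists>\<tau>1. ts = {#\<tau>1#} \<and> \<tau>1 \<in> LW1)"
      by (cases ts) auto
    then show ?case by (metis \<theta>_0)
  next
    case (3 \<tau>)
    then show ?case by (auto simp flip: \<theta>_Suc)
  qed
  then show thesis using that by blast
qed


section \<open>Elementary weights\<close>

text \<open>
  Empty products give the values at \<open>[]\<^bsub>\<bullet>\<^esub>\<close> and \<open>[]\<^bsub>\<theta>\<^sub>q\<^esub>\<close>, and the exponent \<open>q = 0\<close> gives the
  fat roots. Trees outside \<^const>\<open>LW1\<close> get irrelevant values.
\<close>

function Phi_bar ::
  "nat \<Rightarrow> (nat \<Rightarrow> nat \<Rightarrow> real) \<Rightarrow> (nat \<Rightarrow> nat \<Rightarrow> real) \<Rightarrow> ltree \<Rightarrow> nat \<Rightarrow> real" where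
  "Phi_bar s a \<gamma> (Vertex Meagre ts) j =
     (\<Sum>k=1..s. a j k * (\<Prod>\<tau>\<in>#ts. Phi_bar s a \<gamma> \<tau> k))"
| "Phi_bar s a \<gamma> (\<theta> q ts) j =
     (\<Sum>k=1..s. \<gamma> j k * \<gamma> k k ^ q * (\<Prod>\<tau>\<in>#ts. Phi_bar s a \<gamma> \<tau> k))"
| "(\<nexists>ts. \<sigma> = Vertex Meagre ts) \<Longrightarrow> (\<nexists>q ts. \<sigma> = \<theta> q ts) \<Longrightarrow> Phi_bar s a \<gamma> \<sigma> j = 0"
  by (auto simp: \<theta>_inject \<theta>_not_Meagre \<theta>_not_Meagre[symmetric]) (metis surj_pair)
termination
  by (relation "Wellfounded.measure (\<lambda>(s, a, \<gamma>, \<tau>, j). size \<tau>)")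
    (auto simp: size_subtree size_subtree_\<theta> simp del: ltree.size)

function Phi ::
  "nat \<Rightarrow> (nat \<Rightarrow> nat \<Rightarrow> real) \<Rightarrow> (nat \<Rightarrow> nat \<Rightarrow> real) \<Rightarrow> (nat \<Rightarrow> real) \<Rightarrow> (nat \<Rightarrow> real) \<Rightarrow>
   ltree \<Rightarrow> nat \<Rightarrow> real" where
  "Phi s a \<gamma> b g (Vertex Meagre ts) j = b j * (\<Prod>\<tau>\<in>#ts. Phi_bar s a \<gamma> \<tau> j)"
| "Phi s a \<gamma> b g (\<theta> q ts) j = g j * \<gamma> j j ^ q * (\<Prod>\<tau>\<in>#ts. Phi_bar s a \<gamma> \<tau> j)"
| "(\<nexists>ts. \<sigma> = Vertex Meagre ts) \<Longrightarrow> (\<nexists>q ts. \<sigma> = \<theta> q ts) \<Longrightarrow> Phi s a \<gamma> b g \<sigma> j = 0"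
  by (auto simp: \<theta>_inject \<theta>_not_Meagre \<theta>_not_Meagre[symmetric]) (metis surj_pair)
termination by lexicographic_order

end

theory Submission
  imports Defs
begin

text \<open>
  The numerical step and the exact solution are both B-series in \<open>h\<close>: sums over trees of
  \<open>h\<close> to the number of vertices, times a coefficient attached to the tree, times an elementary
  differential built from the derivatives of \<open>F\<close> and \<open>L\<close> at the initial point. Only the
  coefficient distinguishes the two. For the step it is the sum of the elementary weights \<open>Phi\<close>;
  for the solution it is \<open>exact_weight\<close>, which is \<open>1 / \<gamma>(\<tau>)\<close> on \<open>T\<close> and \<open>0\<close> elsewhere because
  \<open>L\<close> does not occur in the differential equation. The two families of conditions together say
  that the coefficients agree up to order \<open>p\<close>, and then so do the expansions.

  The sums run over planar trees, whose children are listed in order. The elementary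
  differential of a vertex with \<open>m\<close> children carries the factor \<open>1 / m!\<close> of Taylor's formula, and
  a tree occurs once for each of its planar forms; this replaces the usual symmetry coefficients,
  so automorphisms never have to be counted. Substituting a B-series that is correct to order
  \<open>n\<close> into \<open>F\<close> (lemma \<open>F_series\<close>) or multiplying it by the matrix (lemma \<open>L_series\<close>) gives a
  series that is again correct to order \<open>n\<close>, and the factor \<open>h\<close> in front of both in the stage
  equations gains one order. Hence the expansion of the stages follows by induction on the order
  (\<open>stage_series\<close>); for the solution, integration supplies the factor \<open>h\<close> (\<open>exact_series\<close>).
  What remains is the start of the induction for the stages, which are defined implicitly: they
  tend to the initial value with an error \<open>O(h)\<close> (\<open>stage_minus_yn\<close>).

  Conversely, each condition is forced by one polynomial system. It has a coordinate for every
  subtree of the given tree \<open>\<tau>\<close> and one further coordinate that is constantly \<open>1\<close>; the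
  coordinate of a meagre vertex has the product of the coordinates of its children as derivative,
  and a chain of \<open>q\<close> square vertices followed by a
  fat one becomes a matrix entry \<open>t\<^sup>q\<close>. All series collapse to a single monomial: the step and the
  solution are known without remainder (\<open>weight_vec_rk\<close>, \<open>local_solution_weight_vec\<close>), and their
  coordinates at \<open>\<tau>\<close> are \<open>h\<close> to the number of vertices of \<open>\<tau>\<close> times the two coefficients.
\<close>

section \<open>Taylor expansion of smooth functions\<close>

lemma RN_iff: "x \<in> RN N \<longleftrightarrow> (\<forall>i\<ge>N. x i = 0)"
  by (simp add: RN_def topspace_Euclidean_space)

text \<open>
  A basic neighbourhood in the product topology restricts only finitely many coordinates, and the
  coordinates with index \<open>\<ge> N\<close> agree anyway, so continuity has a uniform \<open>\<epsilon>\<close>-\<open>\<delta>\<close> form.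
\<close>

lemma continuous_map_Euclidean_space_box:
  assumes f: "continuous_map (Euclidean_space N) euclideanreal f"
    and x: "x \<in> RN N" and e: "e > 0"
  shows "\<exists>d>0. \<forall>z\<in>RN N. (\<forall>i<N. \<bar>z i - x i\<bar> < d) \<longrightarrow> \<bar>f z - f x\<bar> < e"
proof -
  let ?U = "{z \<in> topspace (Euclidean_space N). f z \<in> ball (f x) e}"
  have "openin (Euclidean_space N) ?U"
    by (rule openin_continuous_map_preimage[OF f]) simp
  then obtain W where W: "openin (powertop_real UNIV) W" "?U = W \<inter> {z. \<forall>i\<ge>N. z i = 0}"
    unfolding Euclidean_space_def openin_subtopology by blast
  have "x \<in> W"
    using W(2) x e by (auto simp: RN_def)
  then obtain X where X: "x \<in> PiE UNIV X" "\<And>i. open (X i)" "PiE UNIV X \<subseteq> W"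
    using product_topology_open_contains_basis[OF W(1)] by auto metis
  have "\<exists>d>0. \<forall>t. \<bar>t - x i\<bar> < d \<longrightarrow> t \<in> X i" for i
    using X(1) X(2)[of i] unfolding open_dist by (auto simp: dist_real_def)
  then obtain d where d: "\<And>i. d i > 0" "\<And>i t. \<bar>t - x i\<bar> < d i \<Longrightarrow> t \<in> X i"
    by metis
  define m where "m = Min (insert 1 (d ` {..<N}))"
  have "m > 0" using d(1) by (auto simp: m_def)
  moreover have "\<bar>f z - f x\<bar> < e" if z: "z \<in> RN N" "\<forall>i<N. \<bar>z i - x i\<bar> < m" for z
  proof -
    have "m \<le> d i" if "i < N" for i using that by (auto simp: m_def)
    then have "z i \<in> X i" for i
      using d z x by (cases "i < N") (force simp: RN_iff)+
    then have "z \<in> ?U" using X(3) z(1) W(2) by (auto simp: RN_iff)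
    then show ?thesis by (auto simp: dist_real_def)
  qed
  ultimately show ?thesis by blast
qed

lemma smooth_fun_box:
  assumes "smooth_fun N f" "set is \<subseteq> {..<N}" "x \<in> RN N" "e > 0"
  shows "\<exists>d>0. \<forall>z\<in>RN N. (\<forall>i<N. \<bar>z i - x i\<bar> < d) \<longrightarrow>
           \<bar>foldr partial is f z - foldr partial is f x\<bar> < e"
  using assms continuous_map_Euclidean_space_box unfolding smooth_fun_def by metis

lemma smooth_fun_partial:
  assumes "smooth_fun N f" "i < N"
  shows "smooth_fun N (partial i f)"
proof -
  have "continuous_map (Euclidean_space N) euclideanreal (foldr partial (is @ [i]) f) \<and>
      (\<forall>k<N. \<forall>x\<in>RN N. (\<lambda>t. foldr partial (is @ [i]) f (x(k := t))) field_differentiable at (x k))"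
    if "set is \<subseteq> {..<N}" for "is"
    using assms(1)[unfolded smooth_fun_def, rule_format, of "is @ [i]"] assms(2) that by simp
  then show ?thesis by (simp add: smooth_fun_def)
qed

lemma smooth_fun_foldr_partial:
  assumes "smooth_fun N f" "set is \<subseteq> {..<N}"
  shows "smooth_fun N (foldr partial is f)"
  using assms by (induction "is") (auto intro: smooth_fun_partial)

lemma smooth_fun_has_partial:
  assumes f: "smooth_fun N f" and i: "i < N" and x: "x \<in> RN N"
  shows "((\<lambda>t. f (x(i := t))) has_real_derivative partial i f (x(i := t))) (at t)"
proof -
  have "x(i := t) \<in> RN N" using x i by (auto simp: RN_iff)
  then have "(\<lambda>r. f ((x(i := t))(i := r))) field_differentiable at ((x(i := t)) i)"
    using f i unfolding smooth_fun_def by (metis empty_subsetI foldr.simps(1) id_apply set_empty2)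
  then show ?thesis by (simp add: partial_def DERIV_deriv_iff_field_differentiable)
qed

text \<open>
  A form of the mean value theorem for increments of either sign. The intermediate point differs
  from \<open>x\<close> for a nonzero increment, which is what allows bounds that hold only away from \<open>x\<close>.
\<close>

lemma mean_value_abs:
  fixes f f' :: "real \<Rightarrow> real"
  assumes "\<And>t. \<bar>t - x\<bar> \<le> \<bar>r\<bar> \<Longrightarrow> (f has_real_derivative f' t) (at t)"
  shows "\<exists>c. \<bar>c - x\<bar> \<le> \<bar>r\<bar> \<and> (r \<noteq> 0 \<longrightarrow> c \<noteq> x) \<and> f (x + r) - f x = r * f' c"
proof (cases r "0::real" rule: linorder_cases)
  case less
  then obtain c where "x + r < c" "c < x" "f x - f (x + r) = (x - (x + r)) * f' c"
    using MVT2[of "x + r" x f f'] assms by auto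
  then show ?thesis using less by (intro exI[of _ c]) (auto simp: algebra_simps)
next
  case greater
  then obtain c where "x < c" "c < x + r" "f (x + r) - f x = (x + r - x) * f' c"
    using MVT2[of x "x + r" f f'] assms by auto
  then show ?thesis using greater by (intro exI[of _ c]) (auto simp: algebra_simps)
qed auto

text \<open>
  The chain rule along a line. The coordinates are moved one after the other; each single move is
  governed by the mean value theorem, and continuity of the partial derivatives lets its
  intermediate point be replaced by \<open>x\<close> in the limit.
\<close>

lemma smooth_fun_line_derivative_0:
  assumes f: "smooth_fun N f" and x: "x \<in> RN N" and v: "v \<in> RN N"
  shows "((\<lambda>r. f (\<lambda>i. x i + r * v i)) has_real_derivative (\<Sum>i<N. partial i f x * v i)) (at 0)"
proof -
  \<comment> \<open>Only the first \<open>n\<close> coordinates have been moved along \<open>v\<close>.\<close>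
  define w where "w n r = (\<lambda>i. if i < n then x i + r * v i else x i)" for n :: nat and r
  have wRN: "w n r \<in> RN N" for n r using x v by (auto simp: w_def RN_iff)
  have "((\<lambda>r. f (w n r)) has_real_derivative (\<Sum>i<n. partial i f x * v i)) (at 0)"
    if "n \<le> N" for n using that
  proof (induction n)
    case 0
    then show ?case by (simp add: w_def)
  next
    case (Suc n)
    have "((\<lambda>r. f (w (Suc n) r) - f (w n r)) has_real_derivative partial n f x * v n) (at 0)"
      unfolding has_field_derivative_def has_derivative_at_within
    proof (intro conjI)
      show "bounded_linear ((*) (partial n f x * v n))" by (rule bounded_linear_mult_right)
      have "\<forall>\<^sub>F r in at 0. norm (((f (w (Suc n) r) - f (w n r)) - (f (w (Suc n) 0) - f (w n 0)) -
              partial n f x * v n * (r - 0)) /\<^sub>R norm (r - 0)) < e" if "e > 0" for e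
      proof -
        define e' where "e' = e / (\<bar>v n\<bar> + 1)"
        have "e' > 0" using that by (simp add: e'_def add_nonneg_pos)
        then obtain d where d: "d > 0" "\<And>z. z \<in> RN N \<Longrightarrow> (\<And>i. i < N \<Longrightarrow> \<bar>z i - x i\<bar> < d) \<Longrightarrow>
            \<bar>partial n f z - partial n f x\<bar> < e'"
          using smooth_fun_box[OF f, of "[n]" x e'] x Suc.prems by auto
        \<comment> \<open>\<open>M\<close> exceeds every \<open>\<bar>v i\<bar>\<close>, so \<open>\<bar>r\<bar> < d / M\<close> keeps all moved points in the box of size \<open>d\<close>.\<close>
        define M where "M = (\<Sum>i<N. \<bar>v i\<bar>) + 1"
        have M: "M > 0" by (simp add: M_def add_nonneg_pos sum_nonneg)
        have vM: "\<bar>v i\<bar> < M" if "i < N" for i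
          using member_le_sum[of i "{..<N}" "\<lambda>i. \<bar>v i\<bar>"] that by (simp add: M_def)
        have "\<forall>\<^sub>F r in at 0. \<bar>r\<bar> < d / M \<and> r \<noteq> (0::real)"
          using d(1) M by (auto simp: eventually_at dist_real_def intro!: exI[of _ "d / M"])
        then show ?thesis
        proof eventually_elim
          case (elim r)
          have wS: "w (Suc n) r = (w n r)(n := x n + r * v n)" and wn: "w n r = (w n r)(n := x n)"
            by (auto simp: w_def fun_eq_iff)
          obtain c where c: "\<bar>c - x n\<bar> \<le> \<bar>r * v n\<bar>"
            "f (w (Suc n) r) - f (w n r) = r * v n * partial n f ((w n r)(n := c))"
            using mean_value_abs[of "x n" "r * v n" "\<lambda>t. f ((w n r)(n := t))" "\<lambda>t. partial n f ((w n r)(n := t))"]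
              smooth_fun_has_partial[OF f _ wRN, of n n r] Suc.prems wS wn by auto
          have *: "\<bar>r * v i\<bar> < d" if "i < N" for i
          proof -
            have "\<bar>r * v i\<bar> = \<bar>r\<bar> * \<bar>v i\<bar>" by (simp add: abs_mult)
            also have "\<dots> \<le> \<bar>r\<bar> * M" using vM[OF that] by (intro mult_left_mono) auto
            also have "\<dots> < d" using elim M by (simp add: field_simps)
            finally show ?thesis .
          qed
          have "\<bar>partial n f ((w n r)(n := c)) - partial n f x\<bar> < e'"
          proof (rule d(2))
            show "(w n r)(n := c) \<in> RN N" using wRN[of n r] Suc.prems by (auto simp: RN_iff)
            show "\<bar>((w n r)(n := c)) i - x i\<bar> < d" if "i < N" for i
              using *[OF that] c(1) d(1) by (auto simp: w_def)
          qed
          then have "\<bar>v n\<bar> * \<bar>partial n f ((w n r)(n := c)) - partial n f x\<bar> \<le> \<bar>v n\<bar> * e'"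
            by (intro mult_left_mono) auto
          also have "\<dots> < e" using that by (simp add: e'_def field_simps)
          finally have "\<bar>v n * (partial n f ((w n r)(n := c)) - partial n f x)\<bar> < e"
            by (simp add: abs_mult)
          moreover have "w (Suc n) 0 = w n 0" by (auto simp: w_def fun_eq_iff)
          ultimately have "(f (w (Suc n) r) - f (w n r)) - (f (w (Suc n) 0) - f (w n 0)) -
              partial n f x * v n * (r - 0) = r * (v n * (partial n f ((w n r)(n := c)) - partial n f x))"
            using c(2) by (simp add: algebra_simps)
          with \<open>\<bar>v n * (partial n f ((w n r)(n := c)) - partial n f x)\<bar> < e\<close> elim
          show ?case by (simp add: abs_mult mult.assoc[symmetric])
        qed
      qed
      then show "((\<lambda>r. ((f (w (Suc n) r) - f (w n r)) - (f (w (Suc n) 0) - f (w n 0)) -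
              partial n f x * v n * (r - 0)) /\<^sub>R norm (r - 0)) \<longlongrightarrow> 0) (at 0)"
        by (intro tendstoI) (simp only: dist_norm diff_zero)
    qed
    from DERIV_add[OF this Suc.IH] Suc.prems show ?case by (simp add: add.commute)
  qed
  from this[of N] have "((\<lambda>r. f (w N r)) has_real_derivative (\<Sum>i<N. partial i f x * v i)) (at 0)" by simp
  moreover have "w N r = (\<lambda>i. x i + r * v i)" for r using x v by (auto simp: w_def RN_iff)
  ultimately show ?thesis by simp
qed

lemma smooth_fun_line_derivative:
  assumes f: "smooth_fun N f" and x: "x \<in> RN N" and v: "v \<in> RN N"
  shows "((\<lambda>r. f (\<lambda>i. x i + r * v i)) has_real_derivative
           (\<Sum>i<N. partial i f (\<lambda>i. x i + r * v i) * v i)) (at r)"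
proof -
  let ?z = "\<lambda>i. x i + r * v i"
  have "?z \<in> RN N" using x v by (simp add: RN_iff)
  from smooth_fun_line_derivative_0[OF f this v]
  have "((\<lambda>q. f (\<lambda>i. x i + (q + r) * v i)) has_real_derivative (\<Sum>i<N. partial i f ?z * v i)) (at 0)"
    by (simp add: algebra_simps)
  then show ?thesis using DERIV_shift[of "\<lambda>q. f (\<lambda>i. x i + q * v i)" _ 0 r] by simp
qed

definition index_lists :: "nat \<Rightarrow> nat \<Rightarrow> nat list set" where
  "index_lists N m = {is. set is \<subseteq> {..<N} \<and> length is = m}"

lemma finite_index_lists [simp]: "finite (index_lists N m)"
  unfolding index_lists_def by (rule finite_lists_length_eq) simp

lemma index_lists_0 [simp]: "index_lists N 0 = {[]}"
  by (auto simp: index_lists_def)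

lemma sum_index_lists_Suc:
  "(\<Sum>is\<in>index_lists N (Suc m). f is) = (\<Sum>is\<in>index_lists N m. \<Sum>i<N. f (i # is))"
proof -
  have "index_lists N (Suc m) = (\<lambda>(is, i). i # is) ` (index_lists N m \<times> {..<N})"
    by (auto simp: index_lists_def length_Suc_conv image_iff)
  moreover have "inj_on (\<lambda>(is, i). i # is) (index_lists N m \<times> {..<N})"
    by (auto simp: inj_on_def)
  ultimately show ?thesis
    by (simp add: sum.reindex sum.cartesian_product case_prod_unfold)
qed

text \<open>
  Taylor's formula with Lagrange remainder, obtained from the one-dimensional formula on the segment
  from \<open>x\<close> to \<open>x + v\<close>. Derivatives are indexed by lists of directions rather than by multi-indices,
  which matches the ordered children of planar trees.
\<close>

lemma smooth_fun_Taylor: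
  assumes f: "smooth_fun N f" and x: "x \<in> RN N" and v: "v \<in> RN N"
  shows "\<exists>t. \<bar>t\<bar> \<le> 1 \<and> f (\<lambda>i. x i + v i) =
     (\<Sum>m<n. (\<Sum>is\<in>index_lists N m. foldr partial is f x * (\<Prod>i\<leftarrow>is. v i)) / fact m) +
     (\<Sum>is\<in>index_lists N n. foldr partial is f (\<lambda>i. x i + t * v i) * (\<Prod>i\<leftarrow>is. v i)) / fact n"
proof -
  define D where "D m r = (\<Sum>is\<in>index_lists N m. foldr partial is f (\<lambda>i. x i + r * v i) * (\<Prod>i\<leftarrow>is. v i))"
    for m r
  have "(D m has_real_derivative D (Suc m) r) (at r)" for m r
  proof -
    have "((\<lambda>r. foldr partial is f (\<lambda>i. x i + r * v i) * (\<Prod>i\<leftarrow>is. v i)) has_real_derivative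
            (\<Sum>i<N. partial i (foldr partial is f) (\<lambda>i. x i + r * v i) * v i) * (\<Prod>i\<leftarrow>is. v i)) (at r)"
      if "is \<in> index_lists N m" for "is"
      using that f x v
      by (intro DERIV_cmult_right smooth_fun_line_derivative smooth_fun_foldr_partial)
        (auto simp: index_lists_def)
    from DERIV_sum[OF this, of "index_lists N m" "\<lambda>is. is"] show ?thesis
      unfolding D_def sum_index_lists_Suc by (simp add: sum_distrib_right mult.assoc)
  qed
  moreover have "D 0 = (\<lambda>r. f (\<lambda>i. x i + r * v i))"
    by (simp add: D_def fun_eq_iff)
  ultimately show ?thesis
    using Maclaurin_all_le[of D "\<lambda>r. f (\<lambda>i. x i + r * v i)" 1 n] by (simp add: D_def)
qed

section \<open>Orders of vanishing at zero\<close>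

lemma power_bigo_at_0:
  "j \<le> k \<Longrightarrow> (\<lambda>h::real. h ^ k) \<in> O[at 0](\<lambda>h. h ^ j)"
proof (intro bigoI[of _ 1])
  assume jk: "j \<le> k"
  have "\<forall>\<^sub>F h in at (0::real). \<bar>h\<bar> < 1"
    by (auto simp: eventually_at dist_real_def intro: exI[of _ 1])
  then show "\<forall>\<^sub>F h in at (0::real). norm (h ^ k) \<le> 1 * norm (h ^ j)"
    by eventually_elim (use jk in \<open>simp add: power_abs power_decreasing\<close>)
qed

lemma bigo_power_mono:
  "f \<in> O[at 0](\<lambda>h::real. h ^ k) \<Longrightarrow> j \<le> k \<Longrightarrow> f \<in> O[at 0](\<lambda>h. h ^ j)"
  using landau_o.big_trans power_bigo_at_0 by blast

lemma bigo_h_imp_tendsto_0: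
  assumes "f \<in> O[at 0](\<lambda>h::real. h)" shows "(f \<longlongrightarrow> (0::real)) (at 0)"
proof -
  have "(\<lambda>h::real. h) \<in> o[at 0](\<lambda>_. 1)"
    by (intro smalloI_tendsto) (auto intro!: tendsto_eq_intros)
  with assms have "f \<in> o[at 0](\<lambda>_. 1)" by (rule landau_o.big_small_trans)
  from smalloD_tendsto[OF this] show ?thesis by simp
qed

lemma prod_list_bigo:
  assumes "\<And>i. i \<in> set is \<Longrightarrow> v i \<in> O[at 0](\<lambda>h::real. h)"
  shows "(\<lambda>h. (\<Prod>i\<leftarrow>is. v i h :: real)) \<in> O[at 0](\<lambda>h. h ^ length is)"
  using assms by (induction "is") (auto intro!: landau_o.big.mult)

text \<open>
  Replacing the factors of a product one at a time changes it by the error of a single factor, since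
  the other factors stay bounded.
\<close>

lemma prod_list_diff_bigo:
  assumes "\<And>i. i \<in> set is \<Longrightarrow> v i \<in> O[at 0](\<lambda>h::real. h)"
    and "\<And>i. i \<in> set is \<Longrightarrow> w i \<in> O[at 0](\<lambda>h::real. h)"
    and "\<And>i. i \<in> set is \<Longrightarrow> (\<lambda>h. v i h - w i h) \<in> O[at 0](\<lambda>h::real. h ^ n)"
  shows "(\<lambda>h. (\<Prod>i\<leftarrow>is. v i h :: real) - (\<Prod>i\<leftarrow>is. w i h)) \<in> O[at 0](\<lambda>h. h ^ n)"
  using assms
proof (induction "is")
  case Nil
  then show ?case by simp
next
  case (Cons i "is")
  have 1: "(\<lambda>h. (\<Prod>i\<leftarrow>is. v i h)) \<in> O[at 0](\<lambda>_. 1)"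
    using bigo_power_mono[OF prod_list_bigo[of "is" v], of 0] Cons.prems by simp
  have 2: "w i \<in> O[at 0](\<lambda>_. 1)"
    using bigo_power_mono[of "w i" 1 0] Cons.prems by simp
  have "(\<lambda>h. (v i h - w i h) * (\<Prod>i\<leftarrow>is. v i h)) \<in> O[at 0](\<lambda>h. h ^ n * 1)"
    using Cons.prems 1 by (intro landau_o.big.mult) auto
  moreover have "(\<lambda>h. w i h * ((\<Prod>i\<leftarrow>is. v i h) - (\<Prod>i\<leftarrow>is. w i h))) \<in> O[at 0](\<lambda>h. 1 * h ^ n)"
    using Cons 2 by (intro landau_o.big.mult) auto
  ultimately have "(\<lambda>h. (v i h - w i h) * (\<Prod>i\<leftarrow>is. v i h) + w i h * ((\<Prod>i\<leftarrow>is. v i h) - (\<Prod>i\<leftarrow>is. w i h)))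
    \<in> O[at 0](\<lambda>h. h ^ n)"
    by (intro sum_in_bigo) simp_all
  moreover have "(\<lambda>h. (\<Prod>i\<leftarrow>i # is. v i h) - (\<Prod>i\<leftarrow>i # is. w i h)) = (\<lambda>h. (v i h - w i h) * (\<Prod>i\<leftarrow>is. v i h) +
      w i h * ((\<Prod>i\<leftarrow>is. v i h) - (\<Prod>i\<leftarrow>is. w i h)))"
    by (simp add: fun_eq_iff algebra_simps)
  ultimately show ?case by (simp only:)
qed

lemma monomial_bigo:
  "m \<le> j \<Longrightarrow> (\<lambda>h::real. h ^ j * x * y) \<in> O[at 0](\<lambda>h. h ^ m)"
  using power_bigo_at_0[of m j] by (simp add: mult.assoc)

lemma bigo_trans_diff:
  fixes f g k :: "real \<Rightarrow> real"
  shows "(\<lambda>h. f h - g h) \<in> O[G](e) \<Longrightarrow> (\<lambda>h. g h - k h) \<in> O[G](e) \<Longrightarrow> (\<lambda>h. f h - k h) \<in> O[G](e)"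
  using sum_in_bigo(1)[of "\<lambda>h. f h - g h" G e "\<lambda>h. g h - k h"] by simp

lemma bounded_if_minus_const:
  fixes f :: "real \<Rightarrow> real"
  assumes "(\<lambda>h. f h - c) \<in> O[at 0](\<lambda>h. h)"
  shows "f \<in> O[at 0](\<lambda>_. 1)"
proof -
  from assms have "(\<lambda>h. f h - c) \<in> O[at 0](\<lambda>h. h ^ 1)" by simp
  from bigo_power_mono[OF this, of 0] have "(\<lambda>h. f h - c) \<in> O[at 0](\<lambda>_. 1)" by simp
  then have "(\<lambda>h. (f h - c) + c) \<in> O[at 0](\<lambda>_. 1)" by (rule sum_in_bigo) simp
  then show ?thesis by simp
qed

text \<open>
  Integration gains one power of \<open>h\<close>. The mean value theorem evaluates the derivative at a point other
  than \<open>0\<close>, where the bound on \<open>w'\<close> applies.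
\<close>

lemma bigo_integrate:
  fixes w w' :: "real \<Rightarrow> real"
  assumes w: "\<forall>\<^sub>F h in nhds 0. (w has_real_derivative w' h) (at h)" and w0: "w 0 = 0"
    and w': "w' \<in> O[at 0](\<lambda>h. h ^ m)"
  shows "w \<in> O[at 0](\<lambda>h. h ^ Suc m)"
proof -
  from w' obtain C where C: "C > 0" "\<forall>\<^sub>F h in at 0. norm (w' h) \<le> C * norm (h ^ m)"
    by (rule landau_o.bigE)
  obtain d1 where d1: "d1 > 0" "\<And>h. \<bar>h\<bar> < d1 \<Longrightarrow> (w has_real_derivative w' h) (at h)"
    using w by (auto simp: eventually_nhds_metric dist_real_def)
  obtain d2 where d2: "d2 > 0" "\<And>h. h \<noteq> 0 \<Longrightarrow> \<bar>h\<bar> < d2 \<Longrightarrow> \<bar>w' h\<bar> \<le> C * \<bar>h\<bar> ^ m"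
    using C(2) by (auto simp: eventually_at dist_real_def power_abs)
  have "norm (w h) \<le> C * norm (h ^ Suc m)" if h: "h \<noteq> 0" "\<bar>h\<bar> < min d1 d2" for h
  proof -
    obtain c where c: "\<bar>c\<bar> \<le> \<bar>h\<bar>" "c \<noteq> 0" "w h = h * w' c"
      using mean_value_abs[of 0 h w w'] d1 h w0 by auto
    have "\<bar>w h\<bar> = \<bar>h\<bar> * \<bar>w' c\<bar>" by (simp add: c abs_mult)
    also have "\<dots> \<le> \<bar>h\<bar> * (C * \<bar>c\<bar> ^ m)"
      using c h d2(2)[of c] by (intro mult_left_mono) auto
    also have "\<dots> \<le> \<bar>h\<bar> * (C * \<bar>h\<bar> ^ m)"
      using c C(1) by (intro mult_left_mono power_mono) auto
    finally show ?thesis by (simp add: power_abs abs_mult mult_ac)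
  qed
  then have "\<forall>\<^sub>F h in at 0. norm (w h) \<le> C * norm (h ^ Suc m)"
    using d1(1) d2(1) by (auto simp: eventually_at dist_real_def intro!: exI[of _ "min d1 d2"])
  then show ?thesis by (rule bigoI)
qed

text \<open>
  Dividing by \<open>h ^ r\<close> leaves a constant bounded by a positive power of \<open>h\<close>.
\<close>

lemma bigo_higher_power_imp_zero:
  assumes "(\<lambda>h::real. h ^ r * c) \<in> O[at 0](\<lambda>h. h ^ (p + 1))" and "r \<le> p"
  shows "c = 0"
proof -
  obtain C where C: "\<forall>\<^sub>F h in at 0. norm (h ^ r * c) \<le> C * norm (h ^ (p + 1))"
    using assms(1) by (rule landau_o.bigE)
  have "\<forall>\<^sub>F h in at (0::real). \<bar>c\<bar> \<le> C * \<bar>h\<bar> ^ (p + 1 - r)"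
    using C eventually_neq_at_within[of 0 0 UNIV]
  proof eventually_elim
    case (elim h)
    have "\<bar>h\<bar> ^ (p + 1) = \<bar>h\<bar> ^ r * \<bar>h\<bar> ^ (p + 1 - r)"
      using assms(2) by (simp flip: power_add)
    then have "\<bar>h\<bar> ^ r * \<bar>c\<bar> \<le> \<bar>h\<bar> ^ r * (C * \<bar>h\<bar> ^ (p + 1 - r))"
      using elim(1) by (simp add: abs_mult power_abs mult_ac)
    then show ?case using elim(2) by simp
  qed
  moreover have "((\<lambda>h::real. C * \<bar>h\<bar> ^ (p + 1 - r)) \<longlongrightarrow> C * \<bar>0\<bar> ^ (p + 1 - r)) (at 0)"
    by (intro tendsto_intros)
  ultimately have "\<bar>c\<bar> \<le> C * \<bar>0\<bar> ^ (p + 1 - r)"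
    by (intro tendsto_lowerbound) auto
  then show ?thesis using assms(2) by (simp add: Suc_diff_le)
qed

text \<open>
  Taylor's formula along a curve that tends to \<open>x\<close> at rate \<open>h\<close>: in the remainder the derivatives are
  evaluated near \<open>x\<close>, hence bounded by continuity, and each of the \<open>n + 1\<close> increments contributes a
  factor \<open>h\<close>.
\<close>

lemma smooth_fun_expansion:
  assumes f: "smooth_fun N f" and x: "x \<in> RN N"
    and uR: "\<forall>\<^sub>F h in at 0. u h \<in> RN N"
    and u: "\<And>k. k < N \<Longrightarrow> (\<lambda>h. u h k - x k) \<in> O[at 0](\<lambda>h::real. h)"
  shows "(\<lambda>h. f (u h) - (\<Sum>m\<le>n. (\<Sum>is\<in>index_lists N m.
            foldr partial is f x * (\<Prod>i\<leftarrow>is. u h i - x i)) / fact m)) \<in> O[at 0](\<lambda>h. h ^ Suc n)"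
proof -
  define P where "P h = (\<Sum>m\<le>n. (\<Sum>is\<in>index_lists N m.
      foldr partial is f x * (\<Prod>i\<leftarrow>is. u h i - x i)) / fact m)" for h
  define R where "R t h = (\<Sum>is\<in>index_lists N (Suc n).
      foldr partial is f (\<lambda>i. x i + t * (u h i - x i)) * (\<Prod>i\<leftarrow>is. u h i - x i)) / fact (Suc n)" for t h
  have "\<exists>t. \<bar>t\<bar> \<le> 1 \<and> f (u h) = P h + R t h" if "u h \<in> RN N" for h
    using smooth_fun_Taylor[OF f x, of "\<lambda>i. u h i - x i" "Suc n"] x that
    unfolding P_def R_def lessThan_Suc_atMost by (simp add: RN_iff)
  then obtain t where t: "\<And>h. u h \<in> RN N \<Longrightarrow> \<bar>t h\<bar> \<le> 1"
    and eq: "\<And>h. u h \<in> RN N \<Longrightarrow> f (u h) = P h + R (t h) h"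
    by metis
  have "(\<lambda>h. foldr partial is f (\<lambda>i. x i + t h * (u h i - x i))) \<in> O[at 0](\<lambda>_. 1)"
    if isN: "set is \<subseteq> {..<N}" for "is"
  proof -
    obtain d where d: "d > 0" "\<And>z. z \<in> RN N \<Longrightarrow> (\<And>i. i < N \<Longrightarrow> \<bar>z i - x i\<bar> < d) \<Longrightarrow>
        \<bar>foldr partial is f z - foldr partial is f x\<bar> < 1"
      using smooth_fun_box[OF f isN x, of 1] by auto
    have "\<forall>\<^sub>F h in at 0. \<forall>i\<in>{..<N}. \<bar>u h i - x i\<bar> < d"
    proof (intro eventually_ball_finite ballI)
      show "\<forall>\<^sub>F h in at 0. \<bar>u h i - x i\<bar> < d" if "i \<in> {..<N}" for i
        using tendstoD[OF bigo_h_imp_tendsto_0[OF u] d(1), of i] that by (simp add: dist_real_def)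
    qed simp
    with uR have "\<forall>\<^sub>F h in at 0. norm (foldr partial is f (\<lambda>i. x i + t h * (u h i - x i))) \<le>
        (\<bar>foldr partial is f x\<bar> + 1) * norm (1::real)"
    proof eventually_elim
      case (elim h)
      have "\<bar>foldr partial is f (\<lambda>i. x i + t h * (u h i - x i)) - foldr partial is f x\<bar> < 1"
      proof (rule d(2))
        show "(\<lambda>i. x i + t h * (u h i - x i)) \<in> RN N" using elim x by (simp add: RN_iff)
        fix i assume "i < N"
        have "\<bar>t h\<bar> * \<bar>u h i - x i\<bar> \<le> 1 * \<bar>u h i - x i\<bar>"
          using t elim by (intro mult_right_mono) auto
        then show "\<bar>x i + t h * (u h i - x i) - x i\<bar> < d"
          using elim \<open>i < N\<close> by (auto simp: abs_mult intro: le_less_trans)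
      qed
      then show ?case by simp
    qed
    then show ?thesis by (rule bigoI)
  qed
  moreover have "(\<lambda>h. \<Prod>i\<leftarrow>is. u h i - x i) \<in> O[at 0](\<lambda>h. h ^ Suc n)"
    if "is \<in> index_lists N (Suc n)" for "is"
    using prod_list_bigo[of "is" "\<lambda>i h. u h i - x i"] u that by (auto simp: index_lists_def)
  ultimately have "(\<lambda>h. foldr partial is f (\<lambda>i. x i + t h * (u h i - x i)) * (\<Prod>i\<leftarrow>is. u h i - x i))
      \<in> O[at 0](\<lambda>h. 1 * h ^ Suc n)" if "is \<in> index_lists N (Suc n)" for "is"
    using that by (intro landau_o.big.mult) (auto simp: index_lists_def)
  then have "(\<lambda>h. R (t h) h) \<in> O[at 0](\<lambda>h. h ^ Suc n)"
    unfolding R_def by (auto intro!: big_sum_in_bigo simp del: power_Suc)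
  moreover have "\<forall>\<^sub>F h in at 0. f (u h) - P h = R (t h) h"
    using uR by eventually_elim (simp add: eq)
  then have "(\<lambda>h. f (u h) - P h) \<in> O[at 0](\<lambda>h. h ^ Suc n) \<longleftrightarrow> (\<lambda>h. R (t h) h) \<in> O[at 0](\<lambda>h. h ^ Suc n)"
    by (rule landau_o.big.in_cong)
  ultimately have "(\<lambda>h. f (u h) - P h) \<in> O[at 0](\<lambda>h. h ^ Suc n)" by (simp only:)
  then show ?thesis by (simp only: P_def)
qed

section \<open>Planar trees\<close>

text \<open>
  Expanding a product of sums: every way of choosing one summand from each factor is a list.
\<close>

lemma prod_list_sum_distrib:
  fixes g :: "'t \<Rightarrow> 'i \<Rightarrow> real"
  assumes "finite A"
  shows "(\<Prod>i\<leftarrow>is. \<Sum>t\<in>A. g t i) =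
    (\<Sum>ts | set ts \<subseteq> A \<and> length ts = length is. prod_list (map2 g ts is))"
proof (induction "is")
  case Nil
  have "{ts :: 't list. set ts \<subseteq> A \<and> length ts = length ([] :: 'i list)} = {[]}" by auto
  then show ?case by simp
next
  case (Cons i "is")
  let ?B = "\<lambda>m. {ts. set ts \<subseteq> A \<and> length ts = m}"
  have "?B (length (i # is)) = (\<lambda>(t, ts). t # ts) ` (A \<times> ?B (length is))"
    by (auto simp: length_Suc_conv image_iff)
  moreover have "inj_on (\<lambda>(t, ts). t # ts) (A \<times> ?B (length is))"
    by (auto simp: inj_on_def)
  ultimately have "(\<Sum>ts\<in>?B (length (i # is)). prod_list (map2 g ts (i # is))) =
      (\<Sum>(t, ts)\<in>A \<times> ?B (length is). g t i * prod_list (map2 g ts is))"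
    by (simp add: sum.reindex case_prod_unfold)
  also have "\<dots> = (\<Sum>t\<in>A. g t i) * (\<Sum>ts\<in>?B (length is). prod_list (map2 g ts is))"
    by (simp add: sum_product sum.cartesian_product)
  finally show ?case by (simp add: Cons.IH)
qed

lemma \<rho>_pos: "\<rho> \<tau> \<ge> 1"
  by (cases \<tau>) simp

lemma \<rho>_\<theta>: "\<rho> (\<theta> q ts) = Suc q + (\<Sum>\<tau>\<in>#ts. \<rho> \<tau>)"
  by (induction q) (simp_all add: \<theta>_0 \<theta>_Suc)

text \<open>
  The forms of trees in \<open>LW1\<close> with their subtrees listed in order: a meagre root, a chain of \<open>q\<close>
  square vertices that ends in a fat leaf, and such a chain with one subtree below the fat vertex.
\<close>

datatype planar = Node "planar list" | Chain_end nat | Chain nat planar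

primrec forget :: "planar \<Rightarrow> ltree" where
  "forget (Node ts) = Vertex Meagre (mset (map forget ts))"
| "forget (Chain_end q) = \<theta> q {#}"
| "forget (Chain q t) = \<theta> q {#forget t#}"

lemma \<theta>_in_LW1: "size ts \<le> 1 \<Longrightarrow> set_mset ts \<subseteq> LW1 \<Longrightarrow> \<theta> q ts \<in> LW1"
proof (induction q)
  case 0
  then show ?case by (auto simp: \<theta>_0 intro!: LW1.intros)
next
  case (Suc q)
  have "root_kind (\<theta> q ts) \<in> {Square, Fat}" by (cases q) (auto simp: \<theta>_0 \<theta>_Suc)
  then show ?case using Suc by (auto simp: \<theta>_Suc intro!: LW1.intros)
qed

lemma forget_in_LW1: "forget t \<in> LW1"
  by (induction t) (auto intro!: LW1.intros \<theta>_in_LW1)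

abbreviation tree_order :: "planar \<Rightarrow> nat" where
  "tree_order t \<equiv> \<rho> (forget t)"

lemma tree_order_Node: "tree_order (Node ts) = Suc (\<Sum>t\<leftarrow>ts. tree_order t)"
  by (simp add: sum_mset_sum_list[symmetric] image_mset.compositionality comp_def)

text \<open>
  The set for \<open>n\<close> contains every planar tree with at most \<open>n\<close> vertices. It also contains finitely many
  larger trees, which contribute only to the remainder; keeping them makes the recursion and the
  splitting of sums over trees uniform.
\<close>

primrec trees :: "nat \<Rightarrow> planar set" where
  "trees 0 = {}"
| "trees (Suc n) = Node ` {ts. set ts \<subseteq> trees n \<and> length ts \<le> n} \<union> Chain_end ` {..n} \<union>
     (\<lambda>(q, t). Chain q t) ` ({..n} \<times> trees n)"

abbreviation forests :: "nat \<Rightarrow> planar list set" where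
  "forests n \<equiv> {ts. set ts \<subseteq> trees n \<and> length ts \<le> n}"

lemma finite_trees [simp]: "finite (trees n)"
  by (induction n) (auto intro!: finite_lists_length_le)

lemma finite_forests [simp]: "finite (forests n)"
  by (rule finite_lists_length_le) simp

lemma sum_trees_Suc:
  "(\<Sum>t\<in>trees (Suc n). f t) = (\<Sum>ts\<in>forests n. f (Node ts)) + (\<Sum>q\<le>n. f (Chain_end q)) +
     (\<Sum>q\<le>n. \<Sum>t\<in>trees n. f (Chain q t))"
proof -
  let ?A = "Node ` forests n" and ?B = "Chain_end ` {..n}" and ?C = "(\<lambda>(q, t). Chain q t) ` ({..n} \<times> trees n)"
  have "sum f (trees (Suc n)) = sum f (?A \<union> ?B) + sum f ?C"
    unfolding trees.simps by (rule sum.union_disjoint) auto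
  also have "sum f (?A \<union> ?B) = sum f ?A + sum f ?B"
    by (rule sum.union_disjoint) auto
  also have "sum f ?A = (\<Sum>ts\<in>forests n. f (Node ts))"
    by (simp add: sum.reindex inj_on_def)
  also have "sum f ?B = (\<Sum>q\<le>n. f (Chain_end q))"
    by (simp add: sum.reindex inj_on_def)
  also have "sum f ?C = (\<Sum>q\<le>n. \<Sum>t\<in>trees n. f (Chain q t))"
    by (simp add: sum.reindex inj_on_def sum.cartesian_product case_prod_unfold)
  finally show ?thesis .
qed

lemma sum_forests:
  "(\<Sum>ts\<in>forests n. f ts) = (\<Sum>m\<le>n. \<Sum>ts | set ts \<subseteq> trees n \<and> length ts = m. f ts)"
proof -
  have "(\<Sum>m\<le>n. \<Sum>ts | ts \<in> forests n \<and> length ts = m. f ts) = (\<Sum>ts\<in>forests n. f ts)"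
    by (rule sum.group) auto
  moreover have "{ts \<in> forests n. length ts = m} = {ts. set ts \<subseteq> trees n \<and> length ts = m}" if "m \<le> n" for m
    using that by auto
  then have "(\<Sum>m\<le>n. \<Sum>ts | ts \<in> forests n \<and> length ts = m. f ts) =
      (\<Sum>m\<le>n. \<Sum>ts | set ts \<subseteq> trees n \<and> length ts = m. f ts)"
    by (intro sum.cong) auto
  ultimately show ?thesis by simp
qed

lemma prod_mset_forget: "(\<Prod>\<tau>\<in>#mset (map forget ts). f \<tau> :: real) = (\<Prod>t\<leftarrow>ts. f (forget t))"
  by (simp add: prod_mset_prod_list[symmetric] image_mset.compositionality comp_def)

section \<open>Exact weights\<close>

lemma T_Vertex_iff: "Vertex c ts \<in> T \<longleftrightarrow> c = Meagre \<and> set_mset ts \<subseteq> T"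
  by (subst T.simps) auto

definition exact_weight :: "ltree \<Rightarrow> real" where
  "exact_weight \<tau> = (if \<tau> \<in> T then 1 / real (tree_density \<tau>) else 0)"

text \<open>
  This is the recursion for \<open>\<gamma>\<close>, extended by zero: if some subtree lies outside \<open>T\<close>, so does the tree,
  and both sides vanish.
\<close>

lemma exact_weight_Meagre:
  "real (\<rho> (Vertex Meagre ts)) * exact_weight (Vertex Meagre ts) = (\<Prod>\<tau>\<in>#ts. exact_weight \<tau>)"
proof (cases "set_mset ts \<subseteq> T")
  case True
  then have "(\<Prod>\<tau>\<in>#ts. exact_weight \<tau>) = 1 / real (\<Prod>\<tau>\<in>#ts. tree_density \<tau>)"
    by (induction ts) (auto simp: exact_weight_def)
  then show ?thesis using True
    by (simp add: exact_weight_def T_Vertex_iff del: \<rho>.simps) (simp add: field_simps)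
next
  case False
  then have "0 \<in># image_mset exact_weight ts" by (force simp: exact_weight_def)
  then have "(\<Prod>\<tau>\<in>#ts. exact_weight \<tau>) = 0" by (simp add: prod_mset_zero_iff)
  then show ?thesis using False by (simp add: exact_weight_def T_Vertex_iff)
qed

lemma exact_weight_\<theta>: "exact_weight (\<theta> q ts) = 0"
proof -
  have "\<theta> q ts \<notin> T"
    by (metis T_Vertex_iff \<theta>_not_Meagre ltree.exhaust)
  then show ?thesis by (simp add: exact_weight_def)
qed

section \<open>B-series of smooth data\<close>

locale smooth_data =
  fixes N :: nat and F :: "(nat \<Rightarrow> real) \<Rightarrow> nat \<Rightarrow> real" and L :: "real \<Rightarrow> nat \<Rightarrow> nat \<Rightarrow> real"
    and tn :: real and yn :: "nat \<Rightarrow> real"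
  assumes F: "smooth_field N F" and L: "smooth_matrix N L" and yn: "yn \<in> RN N"
begin

definition L_coeff :: "nat \<Rightarrow> nat \<Rightarrow> nat \<Rightarrow> real" where
  "L_coeff q k l = (deriv ^^ q) (\<lambda>t. L t k l) tn / fact q"

text \<open>
  The elementary differentials, normalised so that the coefficient of a planar tree in a B-series is
  just the weight: the factors \<open>1 / m!\<close> and \<open>1 / q!\<close> of the Taylor expansions of \<open>F\<close> and \<open>L\<close> are included.
\<close>

primrec elem_diff :: "planar \<Rightarrow> nat \<Rightarrow> real" where
  "elem_diff (Node ts) = (\<lambda>k. (\<Sum>is\<in>index_lists N (length ts).
     foldr partial is (\<lambda>x. F x k) yn * prod_list (map2 (\<lambda>d i. d i) (map elem_diff ts) is)) / fact (length ts))"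
| "elem_diff (Chain_end q) = mat_vec N (L_coeff q) yn"
| "elem_diff (Chain q t) = mat_vec N (L_coeff q) (elem_diff t)"

text \<open>
  The B-series with coefficients \<open>c\<close>, up to terms of order \<open>n\<close> and some further ones.
\<close>

definition series :: "(ltree \<Rightarrow> real) \<Rightarrow> nat \<Rightarrow> real \<Rightarrow> nat \<Rightarrow> real" where
  "series c n h k = yn k + (\<Sum>t\<in>trees n. h ^ tree_order t * c (forget t) * elem_diff t k)"

lemma series_minus_yn: "(\<lambda>h. series c n h k - yn k) \<in> O[at 0](\<lambda>h. h)"
proof -
  have "(\<lambda>h. h ^ tree_order t * c (forget t) * elem_diff t k) \<in> O[at 0](\<lambda>h. h)" for t
    using monomial_bigo[OF \<rho>_pos] unfolding power_one_right .
  then show ?thesis unfolding series_def add_diff_cancel_left' by (rule big_sum_in_bigo)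
qed

lemma minus_yn_bigo:
  assumes "(\<lambda>h. u h k - series c n h k) \<in> O[at 0](\<lambda>h. h ^ Suc n)"
  shows "(\<lambda>h. u h k - yn k) \<in> O[at 0](\<lambda>h. h)"
proof (rule bigo_trans_diff[OF _ series_minus_yn])
  show "(\<lambda>h. u h k - series c n h k) \<in> O[at 0](\<lambda>h. h)"
    using bigo_power_mono[OF assms, of 1] unfolding power_one_right by simp
qed

text \<open>
  Taylor's formula writes \<open>F\<close> as a sum over lists of directions of a derivative times a product of
  increments. Inserting the series into each increment and expanding the product yields a sum over
  lists of trees, which are the children of a new meagre root.
\<close>

lemma F_series:
  assumes uR: "\<forall>\<^sub>F h in at 0. u h \<in> RN N"
    and u: "\<And>k. k < N \<Longrightarrow> (\<lambda>h. u h k - series c n h k) \<in> O[at 0](\<lambda>h. h ^ Suc n)"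
    and k: "k < N"
  shows "(\<lambda>h. F (u h) k - (\<Sum>ts\<in>forests n. h ^ (\<Sum>t\<leftarrow>ts. tree_order t) * (\<Prod>t\<leftarrow>ts. c (forget t)) *
           elem_diff (Node ts) k)) \<in> O[at 0](\<lambda>h. h ^ Suc n)"
proof -
  let ?f = "\<lambda>x. F x k"
  have f: "smooth_fun N ?f" using F k by (simp add: smooth_field_def)
  have u': "(\<lambda>h. u h k - yn k) \<in> O[at 0](\<lambda>h. h)" if "k < N" for k
    by (rule minus_yn_bigo[where u = u and k = k, OF u[OF that]])
  have "(\<lambda>h. (\<Prod>i\<leftarrow>is. u h i - yn i) - (\<Prod>i\<leftarrow>is. series c n h i - yn i)) \<in> O[at 0](\<lambda>h. h ^ Suc n)"
    if "is \<in> index_lists N m" for "is" m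
  proof (rule prod_list_diff_bigo)
    fix i assume "i \<in> set is"
    then have i: "i < N" using that by (auto simp: index_lists_def)
    show "(\<lambda>h. u h i - yn i) \<in> O[at 0](\<lambda>h. h)" by (rule u'[OF i])
    show "(\<lambda>h. series c n h i - yn i) \<in> O[at 0](\<lambda>h. h)" by (rule series_minus_yn)
    show "(\<lambda>h. u h i - yn i - (series c n h i - yn i)) \<in> O[at 0](\<lambda>h. h ^ Suc n)"
      using u[OF i] by (simp only: diff_diff_eq2 diff_add_cancel)
  qed
  then have "(\<lambda>h. \<Sum>m\<le>n. (\<Sum>is\<in>index_lists N m. foldr partial is ?f yn *
      ((\<Prod>i\<leftarrow>is. u h i - yn i) - (\<Prod>i\<leftarrow>is. series c n h i - yn i))) / fact m) \<in> O[at 0](\<lambda>h. h ^ Suc n)"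
    by (auto intro!: big_sum_in_bigo simp del: power_Suc)
  then have "(\<lambda>h. (\<Sum>m\<le>n. (\<Sum>is\<in>index_lists N m. foldr partial is ?f yn * (\<Prod>i\<leftarrow>is. u h i - yn i)) / fact m) -
      (\<Sum>m\<le>n. (\<Sum>is\<in>index_lists N m. foldr partial is ?f yn * (\<Prod>i\<leftarrow>is. series c n h i - yn i)) / fact m))
     \<in> O[at 0](\<lambda>h. h ^ Suc n)"
    by (simp add: right_diff_distrib sum_subtractf diff_divide_distrib del: power_Suc)
  from bigo_trans_diff[OF smooth_fun_expansion[OF f yn uR u'] this]
  have *: "(\<lambda>h. F (u h) k - (\<Sum>m\<le>n. (\<Sum>is\<in>index_lists N m.
       foldr partial is ?f yn * (\<Prod>i\<leftarrow>is. series c n h i - yn i)) / fact m)) \<in> O[at 0](\<lambda>h. h ^ Suc n)"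
    by simp
  have "(\<Sum>m\<le>n. (\<Sum>is\<in>index_lists N m. foldr partial is ?f yn * (\<Prod>i\<leftarrow>is. series c n h i - yn i)) / fact m) =
    (\<Sum>ts\<in>forests n. h ^ (\<Sum>t\<leftarrow>ts. tree_order t) * (\<Prod>t\<leftarrow>ts. c (forget t)) * elem_diff (Node ts) k)" for h
  proof -
    let ?g = "\<lambda>t i. h ^ tree_order t * c (forget t) * elem_diff t i"
    let ?lists = "\<lambda>m. {ts. set ts \<subseteq> trees n \<and> length ts = m}"
    have prod: "prod_list (map2 ?g ts is) = h ^ (\<Sum>t\<leftarrow>ts. tree_order t) * (\<Prod>t\<leftarrow>ts. c (forget t)) *
        prod_list (map2 (\<lambda>d i. d i) (map elem_diff ts) is)" if "length ts = length is" for ts "is"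
      using that by (induction rule: list_induct2) (auto simp: power_add)
    have "(\<Sum>is\<in>index_lists N m. foldr partial is ?f yn * (\<Prod>i\<leftarrow>is. series c n h i - yn i)) / fact m =
        (\<Sum>ts\<in>?lists m. h ^ (\<Sum>t\<leftarrow>ts. tree_order t) * (\<Prod>t\<leftarrow>ts. c (forget t)) * elem_diff (Node ts) k)" for m
    proof -
      have "(\<Sum>is\<in>index_lists N m. foldr partial is ?f yn * (\<Prod>i\<leftarrow>is. series c n h i - yn i)) =
          (\<Sum>is\<in>index_lists N m. \<Sum>ts\<in>?lists m. foldr partial is ?f yn * prod_list (map2 ?g ts is))"
        by (intro sum.cong refl)
          (auto simp: series_def prod_list_sum_distrib index_lists_def sum_distrib_left)
      also have "\<dots> = (\<Sum>ts\<in>?lists m. \<Sum>is\<in>index_lists N m. foldr partial is ?f yn * prod_list (map2 ?g ts is))"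
        by (rule sum.swap)
      also have "\<dots> = (\<Sum>ts\<in>?lists m. h ^ (\<Sum>t\<leftarrow>ts. tree_order t) * (\<Prod>t\<leftarrow>ts. c (forget t)) *
          (\<Sum>is\<in>index_lists N m. foldr partial is ?f yn * prod_list (map2 (\<lambda>d i. d i) (map elem_diff ts) is)))"
        unfolding sum_distrib_left
        by (intro sum.cong refl) (auto simp: prod index_lists_def)
      finally have eq: "(\<Sum>is\<in>index_lists N m. foldr partial is ?f yn * (\<Prod>i\<leftarrow>is. series c n h i - yn i)) = \<dots>" .
      show ?thesis
        unfolding eq sum_divide_distrib[where A = "?lists m"] by (intro sum.cong refl) simp
    qed
    then show ?thesis by (simp add: sum_forests)
  qed
  with * show ?thesis by (simp only:)
qed

lemma L_expansion:
  assumes "k < N" "l < N"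
  shows "(\<lambda>h. L (tn + h * \<gamma>) k l - (\<Sum>q\<le>n. h ^ q * \<gamma> ^ q * L_coeff q k l)) \<in> O[at 0](\<lambda>h. h ^ Suc n)"
proof -
  let ?D = "\<lambda>m. (deriv ^^ m) (\<lambda>t. L t k l)"
  have D: "(?D m has_real_derivative ?D (Suc m) t) (at t)" for m t
    using L assms by (simp add: smooth_matrix_def DERIV_deriv_iff_field_differentiable)
  then have D': "((\<lambda>x. ?D m (tn + x)) has_real_derivative ?D (Suc m) (tn + x)) (at x)" for m x
    using DERIV_shift[of "?D m" "?D (Suc m) (tn + x)" x tn] by (simp add: add.commute)
  define S where "S x = (\<Sum>m<Suc n. ?D m tn / fact m * x ^ m)" for x
  define R where "R t x = ?D (Suc n) (tn + t) / fact (Suc n) * x ^ Suc n" for t x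
  have "\<exists>t. \<bar>t\<bar> \<le> \<bar>x\<bar> \<and> L (tn + x) k l = S x + R t x" for x
    using Maclaurin_all_le[of "\<lambda>m x. ?D m (tn + x)" "\<lambda>x. L (tn + x) k l" x "Suc n"] D'
    unfolding S_def R_def by simp
  then obtain \<xi> where \<xi>: "\<And>x. \<bar>\<xi> x\<bar> \<le> \<bar>x\<bar>" and eq: "\<And>x. L (tn + x) k l = S x + R (\<xi> x) x"
    by metis
  have rem: "L (tn + h * \<gamma>) k l - (\<Sum>q\<le>n. h ^ q * \<gamma> ^ q * L_coeff q k l) =
      ?D (Suc n) (tn + \<xi> (h * \<gamma>)) * (\<gamma> ^ Suc n / fact (Suc n)) * h ^ Suc n" for h
    using eq[of "h * \<gamma>"] unfolding S_def R_def L_coeff_def lessThan_Suc_atMost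
    by (simp add: power_mult_distrib mult_ac)
  have "((\<lambda>h. h * \<gamma>) \<longlongrightarrow> 0) (at 0)" by (auto intro!: tendsto_eq_intros)
  then have "((\<lambda>h. \<xi> (h * \<gamma>)) \<longlongrightarrow> 0) (at 0)"
    using \<xi> by (rule_tac Lim_null_comparison[of _ "\<lambda>h. \<bar>h * \<gamma>\<bar>"]) (auto intro: tendsto_rabs_zero)
  then have "((\<lambda>h. tn + \<xi> (h * \<gamma>)) \<longlongrightarrow> tn) (at 0)" by (auto intro!: tendsto_eq_intros)
  then have "((\<lambda>h. ?D (Suc n) (tn + \<xi> (h * \<gamma>))) \<longlongrightarrow> ?D (Suc n) tn) (at 0)"
    using DERIV_isCont[OF D] by (rule isCont_tendsto_compose[rotated])
  then have "(\<lambda>h. ?D (Suc n) (tn + \<xi> (h * \<gamma>))) \<in> O[at 0](\<lambda>_. 1)"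
    by (intro bigoI_tendsto[where c = "?D (Suc n) tn"]) auto
  then have "(\<lambda>h. ?D (Suc n) (tn + \<xi> (h * \<gamma>)) * (\<gamma> ^ Suc n / fact (Suc n)) * h ^ Suc n) \<in> O[at 0](\<lambda>h. 1 * 1 * h ^ Suc n)"
    by (intro landau_o.big.mult) auto
  then show ?thesis unfolding rem by (simp only: mult_1)
qed

text \<open>
  The \<open>q\<close>-th Taylor term of the matrix contributes \<open>q\<close> square vertices and the matrix itself the fat
  one. Applied to the constant term of the series it gives a chain without subtree, applied to the
  term of \<open>t\<close> the chain above \<open>t\<close>.
\<close>

lemma L_series:
  assumes u: "\<And>k. k < N \<Longrightarrow> (\<lambda>h. u h k - series c n h k) \<in> O[at 0](\<lambda>h. h ^ Suc n)"
    and k: "k < N"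
  shows "(\<lambda>h. mat_vec N (L (tn + h * \<gamma>)) (u h) k -
     ((\<Sum>q\<le>n. h ^ q * \<gamma> ^ q * elem_diff (Chain_end q) k) +
      (\<Sum>q\<le>n. \<Sum>t\<in>trees n. h ^ (q + tree_order t) * (\<gamma> ^ q * c (forget t)) * elem_diff (Chain q t) k)))
     \<in> O[at 0](\<lambda>h. h ^ Suc n)"
proof -
  define P where "P l h = (\<Sum>q\<le>n. h ^ q * \<gamma> ^ q * L_coeff q k l)" for l h
  have P1: "P l \<in> O[at 0](\<lambda>_. 1)" for l
    unfolding P_def using monomial_bigo[of 0, OF le0] unfolding power_0 by (rule big_sum_in_bigo)
  have u1: "(\<lambda>h. u h l) \<in> O[at 0](\<lambda>_. 1)" if "l < N" for l
  proof -
    have "(\<lambda>h. u h l - yn l) \<in> O[at 0](\<lambda>h. h ^ 1)"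
      unfolding power_one_right by (rule minus_yn_bigo[where u = u and k = l, OF u[OF that]])
    from bigo_power_mono[OF this, of 0] have "(\<lambda>h. u h l - yn l) \<in> O[at 0](\<lambda>h. 1)" by simp
    then have "(\<lambda>h. (u h l - yn l) + yn l) \<in> O[at 0](\<lambda>h. 1)" by (rule sum_in_bigo) simp
    then show ?thesis by simp
  qed
  have "(\<lambda>h. L (tn + h * \<gamma>) k l * u h l - P l h * series c n h l) \<in> O[at 0](\<lambda>h. h ^ Suc n)" if "l < N" for l
  proof -
    have "(\<lambda>h. (L (tn + h * \<gamma>) k l - P l h) * u h l) \<in> O[at 0](\<lambda>h. h ^ Suc n * 1)"
      using L_expansion[OF k that] u1[OF that] unfolding P_def by (intro landau_o.big.mult)
    moreover have "(\<lambda>h. P l h * (u h l - series c n h l)) \<in> O[at 0](\<lambda>h. 1 * h ^ Suc n)"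
      using P1 u[OF that] by (intro landau_o.big.mult)
    ultimately have "(\<lambda>h. (L (tn + h * \<gamma>) k l - P l h) * u h l + P l h * (u h l - series c n h l))
        \<in> O[at 0](\<lambda>h. h ^ Suc n)"
      by (intro sum_in_bigo) (simp_all only: mult_1 mult_1_right)
    moreover have "(\<lambda>h. L (tn + h * \<gamma>) k l * u h l - P l h * series c n h l) =
       (\<lambda>h. (L (tn + h * \<gamma>) k l - P l h) * u h l + P l h * (u h l - series c n h l))"
      by (simp add: fun_eq_iff algebra_simps)
    ultimately show ?thesis by (simp only:)
  qed
  then have "(\<lambda>h. \<Sum>l<N. L (tn + h * \<gamma>) k l * u h l - P l h * series c n h l) \<in> O[at 0](\<lambda>h. h ^ Suc n)"
    by (intro big_sum_in_bigo) simp
  moreover have "(\<Sum>l<N. L (tn + h * \<gamma>) k l * u h l - P l h * series c n h l) =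
     mat_vec N (L (tn + h * \<gamma>)) (u h) k -
     ((\<Sum>q\<le>n. h ^ q * \<gamma> ^ q * elem_diff (Chain_end q) k) +
      (\<Sum>q\<le>n. \<Sum>t\<in>trees n. h ^ (q + tree_order t) * (\<gamma> ^ q * c (forget t)) * elem_diff (Chain q t) k))" for h
  proof -
    have "P l h * yn l = (\<Sum>q\<le>n. h ^ q * \<gamma> ^ q * (L_coeff q k l * yn l))" for l
      unfolding P_def sum_distrib_right by (simp add: mult_ac)
    moreover have "P l h * (\<Sum>t\<in>trees n. h ^ tree_order t * c (forget t) * elem_diff t l) =
        (\<Sum>q\<le>n. \<Sum>t\<in>trees n. h ^ (q + tree_order t) * (\<gamma> ^ q * c (forget t)) * (L_coeff q k l * elem_diff t l))" for l
      unfolding P_def sum_product by (simp add: power_add mult_ac)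
    ultimately have "(\<Sum>l<N. P l h * series c n h l) =
       (\<Sum>l<N. \<Sum>q\<le>n. h ^ q * \<gamma> ^ q * (L_coeff q k l * yn l)) +
       (\<Sum>l<N. \<Sum>q\<le>n. \<Sum>t\<in>trees n. h ^ (q + tree_order t) * (\<gamma> ^ q * c (forget t)) * (L_coeff q k l * elem_diff t l))"
      by (simp add: series_def distrib_left sum.distrib)
    also have "(\<Sum>l<N. \<Sum>q\<le>n. h ^ q * \<gamma> ^ q * (L_coeff q k l * yn l)) =
        (\<Sum>q\<le>n. \<Sum>l<N. h ^ q * \<gamma> ^ q * (L_coeff q k l * yn l))" by (rule sum.swap)
    also have "(\<Sum>l<N. \<Sum>q\<le>n. \<Sum>t\<in>trees n. h ^ (q + tree_order t) * (\<gamma> ^ q * c (forget t)) * (L_coeff q k l * elem_diff t l)) =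
        (\<Sum>q\<le>n. \<Sum>l<N. \<Sum>t\<in>trees n. h ^ (q + tree_order t) * (\<gamma> ^ q * c (forget t)) * (L_coeff q k l * elem_diff t l))"
      by (rule sum.swap)
    also have "\<dots> = (\<Sum>q\<le>n. \<Sum>t\<in>trees n. \<Sum>l<N. h ^ (q + tree_order t) * (\<gamma> ^ q * c (forget t)) * (L_coeff q k l * elem_diff t l))"
      by (intro sum.cong refl sum.swap)
    finally show ?thesis using k
      by (simp add: mat_vec_def sum_subtractf sum_distrib_left)
  qed
  ultimately show ?thesis by (simp only:)
qed

text \<open>
  One Runge-Kutta combination of already expanded values. The hypotheses on \<open>C\<close> are the recursions
  of both \<open>Phi_bar\<close> and \<open>Phi\<close>, so this serves for the stages and for the final update.
\<close>

lemma rk_series: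
  assumes uR: "\<And>j. j \<in> J \<Longrightarrow> \<forall>\<^sub>F h in at 0. u j h \<in> RN N"
    and u: "\<And>j k. j \<in> J \<Longrightarrow> k < N \<Longrightarrow> (\<lambda>h. u j h k - series (c j) n h k) \<in> O[at 0](\<lambda>h. h ^ Suc n)"
    and C_Meagre: "\<And>ts. C (Vertex Meagre ts) = (\<Sum>j\<in>J. \<alpha> j * (\<Prod>\<tau>\<in>#ts. c j \<tau>))"
    and C_\<theta>: "\<And>q ts. C (\<theta> q ts) = (\<Sum>j\<in>J. \<beta> j * \<gamma> j ^ q * (\<Prod>\<tau>\<in>#ts. c j \<tau>))"
    and k: "k < N"
  shows "(\<lambda>h. yn k + h * (\<Sum>j\<in>J. \<alpha> j * F (u j h) k) +
           h * (\<Sum>j\<in>J. \<beta> j * mat_vec N (L (tn + h * \<gamma> j)) (u j h) k) - series C (Suc n) h k)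
         \<in> O[at 0](\<lambda>h. h ^ Suc (Suc n))"
proof -
  define A where "A j h = (\<Sum>ts\<in>forests n. h ^ (\<Sum>t\<leftarrow>ts. tree_order t) * (\<Prod>t\<leftarrow>ts. c j (forget t)) *
    elem_diff (Node ts) k)" for j h
  define B1 where "B1 j h = (\<Sum>q\<le>n. h ^ q * \<gamma> j ^ q * elem_diff (Chain_end q) k)" for j h
  define B2 where "B2 j h = (\<Sum>q\<le>n. \<Sum>t\<in>trees n. h ^ (q + tree_order t) * (\<gamma> j ^ q * c j (forget t)) *
    elem_diff (Chain q t) k)" for j h
  define M where "M j h = mat_vec N (L (tn + h * \<gamma> j)) (u j h) k" for j h
  have "(\<lambda>h. F (u j h) k - A j h) \<in> O[at 0](\<lambda>h. h ^ Suc n)" if "j \<in> J" for j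
    unfolding A_def using F_series[OF uR[OF that] u[OF that] k] .
  then have 1: "(\<lambda>h. \<Sum>j\<in>J. \<alpha> j * (F (u j h) k - A j h)) \<in> O[at 0](\<lambda>h. h ^ Suc n)"
    by (intro big_sum_in_bigo) (simp del: power_Suc)
  have "(\<lambda>h. M j h - (B1 j h + B2 j h)) \<in> O[at 0](\<lambda>h. h ^ Suc n)" if "j \<in> J" for j
    unfolding M_def B1_def B2_def using L_series[of "u j", OF u[OF that] k] .
  then have 2: "(\<lambda>h. \<Sum>j\<in>J. \<beta> j * (M j h - (B1 j h + B2 j h))) \<in> O[at 0](\<lambda>h. h ^ Suc n)"
    by (intro big_sum_in_bigo) (simp del: power_Suc)
  have 3: "(\<lambda>h. h * ((\<Sum>j\<in>J. \<alpha> j * (F (u j h) k - A j h)) + (\<Sum>j\<in>J. \<beta> j * (M j h - (B1 j h + B2 j h)))))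
      \<in> O[at 0](\<lambda>h. h * h ^ Suc n)"
    by (intro landau_o.big.mult landau_o.big_refl sum_in_bigo(1) 1 2)
  have "series C (Suc n) h k = yn k + h * (\<Sum>j\<in>J. \<alpha> j * A j h) + h * (\<Sum>j\<in>J. \<beta> j * (B1 j h + B2 j h))" for h
  proof -
    have "(\<Sum>ts\<in>forests n. h ^ tree_order (Node ts) * C (forget (Node ts)) * elem_diff (Node ts) k) =
        (\<Sum>ts\<in>forests n. \<Sum>j\<in>J. h * (\<alpha> j * (h ^ (\<Sum>t\<leftarrow>ts. tree_order t) * (\<Prod>t\<leftarrow>ts. c j (forget t)) *
          elem_diff (Node ts) k)))"
      unfolding tree_order_Node
      unfolding forget.simps(1) C_Meagre prod_mset_forget sum_distrib_left sum_distrib_right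
      by (intro sum.cong refl) (simp only: power_Suc mult_ac)
    also have "\<dots> = h * (\<Sum>j\<in>J. \<alpha> j * A j h)"
      unfolding A_def sum_distrib_left by (rule sum.swap)
    finally have node: "(\<Sum>ts\<in>forests n. h ^ tree_order (Node ts) * C (forget (Node ts)) * elem_diff (Node ts) k) =
      h * (\<Sum>j\<in>J. \<alpha> j * A j h)" .
    have "(\<Sum>q\<le>n. h ^ tree_order (Chain_end q) * C (forget (Chain_end q)) * elem_diff (Chain_end q) k) =
        (\<Sum>q\<le>n. \<Sum>j\<in>J. h * (\<beta> j * (h ^ q * \<gamma> j ^ q * elem_diff (Chain_end q) k)))"
      unfolding forget.simps C_\<theta> \<rho>_\<theta> sum_distrib_left sum_distrib_right
      by (intro sum.cong refl) (simp add: mult_ac)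
    also have "\<dots> = h * (\<Sum>j\<in>J. \<beta> j * B1 j h)"
      unfolding B1_def sum_distrib_left by (rule sum.swap)
    finally have leaf: "(\<Sum>q\<le>n. h ^ tree_order (Chain_end q) * C (forget (Chain_end q)) * elem_diff (Chain_end q) k) =
      h * (\<Sum>j\<in>J. \<beta> j * B1 j h)" .
    have "(\<Sum>q\<le>n. \<Sum>t\<in>trees n. h ^ tree_order (Chain q t) * C (forget (Chain q t)) * elem_diff (Chain q t) k) =
        (\<Sum>q\<le>n. \<Sum>t\<in>trees n. \<Sum>j\<in>J. h * (\<beta> j * (h ^ (q + tree_order t) * (\<gamma> j ^ q * c j (forget t)) *
           elem_diff (Chain q t) k)))"
      unfolding forget.simps C_\<theta> \<rho>_\<theta> sum_distrib_left sum_distrib_right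
      by (intro sum.cong refl) (simp add: mult_ac)
    also have "\<dots> = (\<Sum>q\<le>n. \<Sum>j\<in>J. \<Sum>t\<in>trees n. h * (\<beta> j * (h ^ (q + tree_order t) * (\<gamma> j ^ q * c j (forget t)) *
           elem_diff (Chain q t) k)))"
      by (intro sum.cong refl sum.swap)
    also have "\<dots> = h * (\<Sum>j\<in>J. \<beta> j * B2 j h)"
      unfolding B2_def sum_distrib_left by (rule sum.swap)
    finally show ?thesis
      by (simp only: series_def sum_trees_Suc node leaf) (simp add: distrib_left sum.distrib)
  qed
  then have "yn k + h * (\<Sum>j\<in>J. \<alpha> j * F (u j h) k) + h * (\<Sum>j\<in>J. \<beta> j * M j h) - series C (Suc n) h k =
      h * ((\<Sum>j\<in>J. \<alpha> j * (F (u j h) k - A j h)) + (\<Sum>j\<in>J. \<beta> j * (M j h - (B1 j h + B2 j h))))" for h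
    by (simp add: right_diff_distrib sum_subtractf distrib_left)
  with 3 show ?thesis unfolding M_def by (simp only: power_Suc)
qed

section \<open>B-series of the exact solution and of the numerical step\<close>

text \<open>
  Induction on the order. The derivative of the solution is \<open>F\<close> of the solution, and differentiating
  the series turns \<open>h ^ \<rho> \<tau>\<close> into \<open>\<rho> \<tau> * h ^ (\<rho> \<tau> - 1)\<close>; the factor \<open>\<rho> \<tau>\<close> is absorbed by the recursion
  for \<open>exact_weight\<close>. Hence the difference has a derivative that is one power of \<open>h\<close> worse.
\<close>

lemma exact_series:
  assumes y: "local_solution N F tn yn y" and "k < N"
  shows "(\<lambda>h. y (tn + h) k - series exact_weight n h k) \<in> O[at 0](\<lambda>h. h ^ Suc n)"
  using \<open>k < N\<close>
proof (induction n arbitrary: k)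
  have y0: "y tn = yn" and ev: "\<forall>\<^sub>F t in nhds tn. y t \<in> RN N \<and>
      (\<forall>k<N. ((\<lambda>t. y t k) has_real_derivative F (y t) k) (at t))"
    using y by (auto simp: local_solution_def)
  have shift: "filtermap (\<lambda>h. tn + h) (nhds 0) = nhds tn"
    using filtermap_nhds_shift[of "- tn" 0] by (simp add: add.commute)
  from ev have ev': "\<forall>\<^sub>F h in nhds 0. y (tn + h) \<in> RN N \<and>
      (\<forall>k<N. ((\<lambda>t. y t k) has_real_derivative F (y (tn + h)) k) (at (tn + h)))"
    unfolding shift[symmetric] eventually_filtermap .
  have yR: "\<forall>\<^sub>F h in at 0. y (tn + h) \<in> RN N"
    using ev' unfolding eventually_at_filter by eventually_elim simp
  have dy: "\<forall>\<^sub>F h in nhds 0. ((\<lambda>h. y (tn + h) k) has_real_derivative F (y (tn + h)) k) (at h)"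
    if "k < N" for k
    using ev'
  proof eventually_elim
    case (elim h)
    then have "((\<lambda>t. y t k) has_real_derivative F (y (tn + h)) k) (at (h + tn))"
      using that by (simp add: add.commute)
    then show ?case
      using DERIV_shift[of "\<lambda>t. y t k" _ h tn] by (simp add: add.commute)
  qed
  {
    case 0
    from eventually_nhds_x_imp_x[OF dy[OF 0]]
    have "((\<lambda>h. (y (tn + h) k - yn k) / h) \<longlongrightarrow> F yn k) (at 0)"
      by (simp add: DERIV_def y0)
    then have "(\<lambda>h. y (tn + h) k - yn k) \<in> O[at 0](\<lambda>h. h)"
      by (intro bigoI_tendsto[where c = "F yn k"]) (auto simp: eventually_at_filter)
    then show ?case by (simp add: series_def)
  next
    case (Suc n)
    define A where "A h = (\<Sum>ts\<in>forests n. h ^ (\<Sum>t\<leftarrow>ts. tree_order t) * (\<Prod>t\<leftarrow>ts. exact_weight (forget t)) *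
      elem_diff (Node ts) k)" for h
    have dA: "((\<lambda>h. series exact_weight (Suc n) h k) has_real_derivative A h) (at h)" for h
    proof -
      have "series exact_weight (Suc n) h k = yn k + (\<Sum>ts\<in>forests n. h ^ Suc (\<Sum>t\<leftarrow>ts. tree_order t) *
          (exact_weight (forget (Node ts)) * elem_diff (Node ts) k))" for h
        by (simp add: series_def sum_trees_Suc tree_order_Node exact_weight_\<theta> mult.assoc
            del: trees.simps \<rho>.simps forget.simps(1) elem_diff.simps)
      moreover have "((\<lambda>h. yn k + (\<Sum>ts\<in>forests n. h ^ Suc (\<Sum>t\<leftarrow>ts. tree_order t) *
          (exact_weight (forget (Node ts)) * elem_diff (Node ts) k))) has_real_derivative
          0 + (\<Sum>ts\<in>forests n. (real (Suc (\<Sum>t\<leftarrow>ts. tree_order t)) * h ^ (Suc (\<Sum>t\<leftarrow>ts. tree_order t) - Suc 0)) *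
          (exact_weight (forget (Node ts)) * elem_diff (Node ts) k))) (at h)"
        by (intro DERIV_add DERIV_const DERIV_sum DERIV_cmult_right DERIV_pow)
      moreover have w: "real (Suc (\<Sum>t\<leftarrow>ts. tree_order t)) * exact_weight (forget (Node ts)) =
          (\<Prod>t\<leftarrow>ts. exact_weight (forget t))" for ts
        using exact_weight_Meagre[of "mset (map forget ts)"]
        unfolding prod_mset_forget forget.simps(1)[symmetric] tree_order_Node .
      have "(real (Suc (\<Sum>t\<leftarrow>ts. tree_order t)) * h ^ (Suc (\<Sum>t\<leftarrow>ts. tree_order t) - Suc 0)) *
          (exact_weight (forget (Node ts)) * elem_diff (Node ts) k) =
          h ^ (\<Sum>t\<leftarrow>ts. tree_order t) * (\<Prod>t\<leftarrow>ts. exact_weight (forget t)) * elem_diff (Node ts) k" for ts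
        by (simp only: diff_Suc_Suc diff_zero w[symmetric] mult_ac)
      ultimately show ?thesis unfolding A_def by (simp only: add_0)
    qed
    have dw: "(\<lambda>h. F (y (tn + h)) k - A h) \<in> O[at 0](\<lambda>h. h ^ Suc n)"
      unfolding A_def by (rule F_series[OF yR Suc.IH Suc.prems])
    have w: "\<forall>\<^sub>F h in nhds 0. ((\<lambda>h. y (tn + h) k - series exact_weight (Suc n) h k)
        has_real_derivative F (y (tn + h)) k - A h) (at h)"
      using dy[OF Suc.prems] by eventually_elim (intro DERIV_diff dA)
    have w0: "y (tn + 0) k - series exact_weight (Suc n) 0 k = 0"
    proof -
      have "(0::real) ^ tree_order t * x * z = 0" for t x z using \<rho>_pos[of "forget t"] by simp
      then have "series exact_weight (Suc n) 0 k = yn k"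
        by (simp only: series_def sum.neutral_const add_0_right)
      then show ?thesis by (simp add: y0)
    qed
    show ?case by (rule bigo_integrate[OF w w0 dw])
  }
qed

text \<open>
  Induction on the stage. Earlier stages are bounded, so the stage solves a linear system
  \<open>Y = r + h * \<gamma> * L * Y\<close> with bounded \<open>r\<close> and \<open>L\<close>; for small \<open>h\<close> the last term is at most half of the
  norm of \<open>Y\<close>, which bounds \<open>Y\<close>. Then everything multiplied by \<open>h\<close> in the stage equation is bounded.
\<close>

lemma stage_minus_yn:
  fixes Y :: "real \<Rightarrow> nat \<Rightarrow> nat \<Rightarrow> real"
  assumes YR: "\<forall>\<^sub>F h in at 0. \<forall>i\<in>{1..s}. Y h i \<in> RN N"
    and Yeq: "\<forall>\<^sub>F h in at 0. \<forall>i\<in>{1..s}. \<forall>k. Y h i k = yn k + h * (\<Sum>j=1..<i. a i j * F (Y h j) k) +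
       h * (\<Sum>j=1..i. \<gamma> i j * mat_vec N (L (tn + h * \<gamma> j j)) (Y h j) k)"
    and i: "i \<in> {1..s}" and k: "k < N"
  shows "(\<lambda>h. Y h i k - yn k) \<in> O[at 0](\<lambda>h. h)"
  using i k
proof (induction i arbitrary: k rule: less_induct)
  case (less i)
  define M where "M j h k = mat_vec N (L (tn + h * \<gamma> j j)) (Y h j) k" for j h k
  have YR': "\<forall>\<^sub>F h in at 0. Y h j \<in> RN N" if "j \<in> {1..s}" for j
    using YR by eventually_elim (use that in blast)
  have LO: "(\<lambda>h. L (tn + h * \<gamma> j j) k l) \<in> O[at 0](\<lambda>_. 1)" if "k < N" "l < N" for j k l
    using L_expansion[OF that, of "\<gamma> j j" 0] by (intro bounded_if_minus_const[of _ "L_coeff 0 k l"]) simp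
  have FO: "(\<lambda>h. F (Y h j) k) \<in> O[at 0](\<lambda>_. 1)" if j: "j \<in> {1..<i}" and k: "k < N" for j k
  proof -
    have "j \<in> {1..s}" using j less.prems by auto
    have "(\<lambda>h. F (Y h j) k - (\<Sum>m\<le>0. (\<Sum>is\<in>index_lists N m. foldr partial is (\<lambda>x. F x k) yn *
        (\<Prod>i\<leftarrow>is. Y h j i - yn i)) / fact m)) \<in> O[at 0](\<lambda>h. h ^ Suc 0)"
    proof (rule smooth_fun_expansion[OF _ yn YR'[OF \<open>j \<in> {1..s}\<close>]])
      show "smooth_fun N (\<lambda>x. F x k)" using F k by (simp add: smooth_field_def)
      show "(\<lambda>h. Y h j k - yn k) \<in> O[at 0](\<lambda>h. h)" if "k < N" for k
        using less.IH[OF _ \<open>j \<in> {1..s}\<close> that] j by simp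
    qed
    then show ?thesis by (intro bounded_if_minus_const[of _ "F yn k"]) simp
  qed
  have MO: "(\<lambda>h. M j h k) \<in> O[at 0](\<lambda>_. 1)"
    if YO: "\<And>l. l < N \<Longrightarrow> (\<lambda>h. Y h j l) \<in> O[at 0](\<lambda>_. 1)" and k: "k < N" for j k
  proof -
    have "(\<lambda>h. \<Sum>l<N. L (tn + h * \<gamma> j j) k l * Y h j l) \<in> O[at 0](\<lambda>_. 1 * 1)"
      using LO[OF k] YO by (intro big_sum_in_bigo landau_o.big.mult) auto
    then show ?thesis using k by (simp add: M_def mat_vec_def)
  qed
  have MO': "(\<lambda>h. M j h k) \<in> O[at 0](\<lambda>_. 1)" if "j \<in> {1..<i}" "k < N" for j k
    using that less.prems by (intro MO bounded_if_minus_const[OF less.IH]) auto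
  have c1: "(\<lambda>h. \<Sum>j\<in>J. x j * f j h) \<in> O[at 0](\<lambda>_. 1)"
    if "\<And>j. j \<in> J \<Longrightarrow> f j \<in> O[at 0](\<lambda>_. 1)" for J :: "nat set" and x :: "nat \<Rightarrow> real" and f :: "nat \<Rightarrow> real \<Rightarrow> real"
    using that by (intro big_sum_in_bigo) simp
  have h1: "(\<lambda>h. h * f h) \<in> O[at 0](\<lambda>h. h)" if "f \<in> O[at 0](\<lambda>_. 1)" for f :: "real \<Rightarrow> real"
    using landau_o.big.mult[OF landau_o.big_refl that, of "\<lambda>h. h"] by simp
  \<comment> \<open>The explicit part of the stage equation, with the diagonal term \<open>j = i\<close> left out.\<close>
  define r where "r h k = yn k + (h * (\<Sum>j=1..<i. a i j * F (Y h j) k) + h * (\<Sum>j=1..<i. \<gamma> i j * M j h k))" for h k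
  have rO: "(\<lambda>h. \<bar>r h k\<bar>) \<in> O[at 0](\<lambda>_. 1)" if "k < N" for k
  proof -
    have "(\<lambda>h. r h k - yn k) \<in> O[at 0](\<lambda>h. h)"
      unfolding r_def add_diff_cancel_left'
      by (intro sum_in_bigo(1) h1 c1) (use FO MO' that in auto)
    from bounded_if_minus_const[OF this] show ?thesis by simp
  qed
  define R where "R h = (\<Sum>k<N. \<bar>r h k\<bar>)" for h
  define K where "K h = (\<Sum>k<N. \<Sum>l<N. \<bar>\<gamma> i i\<bar> * \<bar>L (tn + h * \<gamma> i i) k l\<bar>)" for h
  define S where "S h = (\<Sum>k<N. \<bar>Y h i k\<bar>)" for h
  have R1: "R \<in> O[at 0](\<lambda>_. 1)"
    unfolding R_def using rO by (intro big_sum_in_bigo) simp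
  have "K \<in> O[at 0](\<lambda>_. 1)"
    unfolding K_def using LO by (intro big_sum_in_bigo) simp
  from tendstoD[OF bigo_h_imp_tendsto_0[OF h1[OF this]], of "1/2"]
  have hK: "\<forall>\<^sub>F h in at 0. \<bar>h * K h\<bar> < 1/2" by (simp add: dist_real_def)
  have Yeq': "\<forall>\<^sub>F h in at 0. \<forall>k. Y h i k = r h k + h * (\<gamma> i i * M i h k)"
    using Yeq
  proof eventually_elim
    case (elim h)
    have "{1..i} = insert i {1..<i}" using less.prems by auto
    then show ?case using elim less.prems by (simp add: r_def M_def distrib_left)
  qed
  have SR: "\<forall>\<^sub>F h in at 0. S h \<le> 2 * R h"
    using Yeq' hK
  proof eventually_elim
    case (elim h)
    have S0: "S h \<ge> 0" by (simp add: S_def sum_nonneg)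
    have "\<bar>Y h i k\<bar> \<le> \<bar>r h k\<bar> + (\<Sum>l<N. \<bar>\<gamma> i i\<bar> * \<bar>L (tn + h * \<gamma> i i) k l\<bar>) * (\<bar>h\<bar> * S h)" if "k < N" for k
    proof -
      have "\<bar>M i h k\<bar> \<le> (\<Sum>l<N. \<bar>L (tn + h * \<gamma> i i) k l\<bar> * \<bar>Y h i l\<bar>)"
        using that sum_abs[of "\<lambda>l. L (tn + h * \<gamma> i i) k l * Y h i l" "{..<N}"]
        by (simp add: M_def mat_vec_def abs_mult)
      also have "\<dots> \<le> (\<Sum>l<N. \<bar>L (tn + h * \<gamma> i i) k l\<bar> * S h)"
        by (intro sum_mono mult_left_mono) (auto simp: S_def intro!: member_le_sum)
      finally have "\<bar>h\<bar> * \<bar>\<gamma> i i\<bar> * \<bar>M i h k\<bar> \<le> \<bar>h\<bar> * \<bar>\<gamma> i i\<bar> * (\<Sum>l<N. \<bar>L (tn + h * \<gamma> i i) k l\<bar> * S h)"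
        by (intro mult_left_mono) auto
      also have "\<dots> = (\<Sum>l<N. \<bar>\<gamma> i i\<bar> * \<bar>L (tn + h * \<gamma> i i) k l\<bar>) * (\<bar>h\<bar> * S h)"
        by (simp add: sum_distrib_left sum_distrib_right mult_ac)
      finally have "\<bar>h * (\<gamma> i i * M i h k)\<bar> \<le> \<dots>" by (simp add: abs_mult mult_ac)
      moreover have "\<bar>Y h i k\<bar> \<le> \<bar>r h k\<bar> + \<bar>h * (\<gamma> i i * M i h k)\<bar>"
        using elim(1) abs_triangle_ineq by metis
      ultimately show ?thesis by linarith
    qed
    then have "S h \<le> (\<Sum>k<N. \<bar>r h k\<bar> + (\<Sum>l<N. \<bar>\<gamma> i i\<bar> * \<bar>L (tn + h * \<gamma> i i) k l\<bar>) * (\<bar>h\<bar> * S h))"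
      unfolding S_def by (intro sum_mono) simp
    also have "\<dots> = R h + K h * (\<bar>h\<bar> * S h)"
      by (simp add: R_def K_def sum.distrib sum_distrib_right)
    also have "K h * (\<bar>h\<bar> * S h) \<le> \<bar>K h\<bar> * (\<bar>h\<bar> * S h)"
      using S0 by (intro mult_right_mono) auto
    also have "\<dots> = \<bar>h * K h\<bar> * S h" by (simp add: abs_mult mult_ac)
    also have "\<bar>h * K h\<bar> * S h \<le> 1/2 * S h" using elim(2) S0 by (intro mult_right_mono) auto
    finally show ?case by simp
  qed
  have YO: "(\<lambda>h. Y h i l) \<in> O[at 0](\<lambda>_. 1)" if "l < N" for l
  proof (rule landau_o.big_trans[OF _ R1], rule bigoI)
    show "\<forall>\<^sub>F h in at 0. norm (Y h i l) \<le> 2 * norm (R h)"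
      using SR
    proof eventually_elim
      case (elim h)
      have "\<bar>Y h i l\<bar> \<le> S h" using that by (auto simp: S_def intro!: member_le_sum)
      then show ?case using elim by simp
    qed
  qed
  have "(\<lambda>h. h * ((\<Sum>j=1..<i. a i j * F (Y h j) k) + (\<Sum>j=1..i. \<gamma> i j * M j h k))) \<in> O[at 0](\<lambda>h. h)"
  proof (intro h1 sum_in_bigo(1) c1)
    show "(\<lambda>h. F (Y h j) k) \<in> O[at 0](\<lambda>_. 1)" if "j \<in> {1..<i}" for j
      using FO that less.prems by blast
    show "(\<lambda>h. M j h k) \<in> O[at 0](\<lambda>_. 1)" if "j \<in> {1..i}" for j
      using MO'[of j k] MO[of i k, OF YO] that less.prems by (cases "j = i") auto
  qed
  moreover have "\<forall>\<^sub>F h in at 0. Y h i k - yn k =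
      h * ((\<Sum>j=1..<i. a i j * F (Y h j) k) + (\<Sum>j=1..i. \<gamma> i j * M j h k))"
    using Yeq
  proof eventually_elim
    case (elim h)
    then have "Y h i k = yn k + h * (\<Sum>j=1..<i. a i j * F (Y h j) k) + h * (\<Sum>j=1..i. \<gamma> i j * M j h k)"
      using less.prems unfolding M_def by blast
    then show ?case by (simp add: distrib_left)
  qed
  then have "(\<lambda>h. Y h i k - yn k) \<in> O[at 0](\<lambda>h. h) \<longleftrightarrow>
    (\<lambda>h. h * ((\<Sum>j=1..<i. a i j * F (Y h j) k) + (\<Sum>j=1..i. \<gamma> i j * M j h k))) \<in> O[at 0](\<lambda>h. h)"
    by (rule landau_o.big.in_cong)
  ultimately show ?case by (simp only:)
qed

text \<open>
  Induction on the order for all stages at once. Correct expansions of the stages to order \<open>n\<close>, put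
  into the right-hand side of the stage equation, give expansions to order \<open>n + 1\<close>, and the resulting
  coefficients obey the recursion for \<open>Phi_bar\<close>.
\<close>

lemma stage_series:
  fixes Y :: "real \<Rightarrow> nat \<Rightarrow> nat \<Rightarrow> real"
  assumes a: "\<And>i j. i \<in> {1..s} \<Longrightarrow> j \<in> {1..s} \<Longrightarrow> j \<ge> i \<Longrightarrow> a i j = 0"
    and \<gamma>: "\<And>i j. i \<in> {1..s} \<Longrightarrow> j \<in> {1..s} \<Longrightarrow> j > i \<Longrightarrow> \<gamma> i j = 0"
    and YR: "\<forall>\<^sub>F h in at 0. \<forall>i\<in>{1..s}. Y h i \<in> RN N"
    and Yeq: "\<forall>\<^sub>F h in at 0. \<forall>i\<in>{1..s}. \<forall>k. Y h i k = yn k + h * (\<Sum>j=1..<i. a i j * F (Y h j) k) +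
       h * (\<Sum>j=1..i. \<gamma> i j * mat_vec N (L (tn + h * \<gamma> j j)) (Y h j) k)"
    and i: "i \<in> {1..s}" and k: "k < N"
  shows "(\<lambda>h. Y h i k - series (\<lambda>\<tau>. Phi_bar s a \<gamma> \<tau> i) n h k) \<in> O[at 0](\<lambda>h. h ^ Suc n)"
  using i k
proof (induction n arbitrary: i k)
  case 0
  then show ?case using stage_minus_yn[OF YR Yeq] by (simp add: series_def)
next
  case (Suc n)
  let ?E = "\<lambda>h. yn k + h * (\<Sum>j\<in>{1..s}. a i j * F (Y h j) k) +
           h * (\<Sum>j\<in>{1..s}. \<gamma> i j * mat_vec N (L (tn + h * \<gamma> j j)) (Y h j) k)"
  let ?S = "series (\<lambda>\<tau>. Phi_bar s a \<gamma> \<tau> i) (Suc n)"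
  have "(\<lambda>h. ?E h - ?S h k) \<in> O[at 0](\<lambda>h. h ^ Suc (Suc n))"
  proof (rule rk_series[where c = "\<lambda>j \<tau>. Phi_bar s a \<gamma> \<tau> j"])
    show "\<forall>\<^sub>F h in at 0. Y h j \<in> RN N" if "j \<in> {1..s}" for j
      using YR by eventually_elim (use that in blast)
  qed (use Suc in auto)
  moreover have "\<forall>\<^sub>F h in at 0. Y h i k - ?S h k = ?E h - ?S h k"
    using Yeq
  proof eventually_elim
    case (elim h)
    have "(\<Sum>j=1..<i. a i j * F (Y h j) k) = (\<Sum>j=1..s. a i j * F (Y h j) k)"
      using Suc.prems a by (intro sum.mono_neutral_left) auto
    moreover have "(\<Sum>j=1..i. \<gamma> i j * mat_vec N (L (tn + h * \<gamma> j j)) (Y h j) k) =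
        (\<Sum>j=1..s. \<gamma> i j * mat_vec N (L (tn + h * \<gamma> j j)) (Y h j) k)"
      using Suc.prems \<gamma> by (intro sum.mono_neutral_left) auto
    ultimately show ?case using elim Suc.prems(1) by simp
  qed
  then have "(\<lambda>h. Y h i k - ?S h k) \<in> O[at 0](\<lambda>h. h ^ Suc (Suc n)) \<longleftrightarrow>
      (\<lambda>h. ?E h - ?S h k) \<in> O[at 0](\<lambda>h. h ^ Suc (Suc n))"
    by (rule landau_o.big.in_cong)
  ultimately show ?case by (simp only:)
qed

text \<open>
  Both series run over the same trees with the same elementary differentials. A tree with at most
  \<open>p\<close> vertices contributes nothing to the difference because its coefficients agree, and a larger
  one is absorbed by the error term.
\<close>

lemma local_error_bigo:
  assumes a: "\<And>i j. i \<in> {1..s} \<Longrightarrow> j \<in> {1..s} \<Longrightarrow> j \<ge> i \<Longrightarrow> a i j = 0"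
    and \<gamma>: "\<And>i j. i \<in> {1..s} \<Longrightarrow> j \<in> {1..s} \<Longrightarrow> j > i \<Longrightarrow> \<gamma> i j = 0"
    and weights: "\<And>\<tau>. \<tau> \<in> LW1 \<Longrightarrow> \<rho> \<tau> \<le> p \<Longrightarrow> (\<Sum>j=1..s. Phi s a \<gamma> b g \<tau> j) = exact_weight \<tau>"
    and y: "local_solution N F tn yn y"
    and step: "\<forall>\<^sub>F h in at 0. lirkw1_step s a \<gamma> b g N F L tn yn h (\<eta> h)"
    and k: "k < N"
  shows "(\<lambda>h. \<eta> h k - y (tn + h) k) \<in> O[at 0](\<lambda>h. h ^ (p + 1))"
proof -
  define P where "P h Y \<longleftrightarrow> (\<forall>i\<in>{1..s}. Y i \<in> RN N) \<and>
        (\<forall>i\<in>{1..s}. \<forall>k.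
           Y i k = yn k + h * (\<Sum>j=1..<i. a i j * F (Y j) k)
                   + h * (\<Sum>j=1..i. \<gamma> i j * mat_vec N (L (tn + h * \<gamma> j j)) (Y j) k)) \<and>
        (\<forall>k. \<eta> h k = yn k + h * (\<Sum>i=1..s. b i * F (Y i) k)
                   + h * (\<Sum>i=1..s. g i * mat_vec N (L (tn + h * \<gamma> i i)) (Y i) k))" for h Y
  define Y where "Y h = (SOME Y. P h Y)" for h
  have ev: "\<forall>\<^sub>F h in at 0. P h (Y h)"
    using step
  proof eventually_elim
    case (elim h)
    then have "\<exists>Y. P h Y" unfolding lirkw1_step_def P_def .
    then show ?case unfolding Y_def by (rule someI_ex)
  qed
  have YR: "\<forall>\<^sub>F h in at 0. \<forall>i\<in>{1..s}. Y h i \<in> RN N"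
    using ev by eventually_elim (simp add: P_def)
  have Yeq: "\<forall>\<^sub>F h in at 0. \<forall>i\<in>{1..s}. \<forall>k. Y h i k = yn k + h * (\<Sum>j=1..<i. a i j * F (Y h j) k) +
       h * (\<Sum>j=1..i. \<gamma> i j * mat_vec N (L (tn + h * \<gamma> j j)) (Y h j) k)"
    using ev by eventually_elim (unfold P_def, blast)
  define W where "W \<tau> = (\<Sum>j=1..s. Phi s a \<gamma> b g \<tau> j)" for \<tau>
  let ?E = "\<lambda>h. yn k + h * (\<Sum>j\<in>{1..s}. b j * F (Y h j) k) +
           h * (\<Sum>j\<in>{1..s}. g j * mat_vec N (L (tn + h * \<gamma> j j)) (Y h j) k)"
  have "(\<lambda>h. ?E h - series W (Suc p) h k) \<in> O[at 0](\<lambda>h. h ^ Suc (Suc p))"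
  proof (rule rk_series[where c = "\<lambda>j \<tau>. Phi_bar s a \<gamma> \<tau> j"])
    show "\<forall>\<^sub>F h in at 0. Y h j \<in> RN N" if "j \<in> {1..s}" for j
      using YR by eventually_elim (use that in blast)
    show "(\<lambda>h. Y h j k - series (\<lambda>\<tau>. Phi_bar s a \<gamma> \<tau> j) p h k) \<in> O[at 0](\<lambda>h. h ^ Suc p)"
      if "j \<in> {1..s}" "k < N" for j k
      by (rule stage_series[OF a \<gamma> YR Yeq that])
  qed (use k in \<open>auto simp: W_def\<close>)
  moreover have "\<forall>\<^sub>F h in at 0. \<eta> h k - series W (Suc p) h k = ?E h - series W (Suc p) h k"
    using ev by eventually_elim (simp add: P_def)
  then have "(\<lambda>h. \<eta> h k - series W (Suc p) h k) \<in> O[at 0](\<lambda>h. h ^ Suc (Suc p)) \<longleftrightarrow>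
      (\<lambda>h. ?E h - series W (Suc p) h k) \<in> O[at 0](\<lambda>h. h ^ Suc (Suc p))"
    by (rule landau_o.big.in_cong)
  ultimately have "(\<lambda>h. \<eta> h k - series W (Suc p) h k) \<in> O[at 0](\<lambda>h. h ^ Suc (Suc p))"
    by (simp only:)
  from bigo_power_mono[OF this, of "Suc p"]
  have num: "(\<lambda>h. \<eta> h k - series W (Suc p) h k) \<in> O[at 0](\<lambda>h. h ^ Suc p)" by (simp del: power_Suc)
  have "(\<lambda>h. series exact_weight (Suc p) h k - y (tn + h) k) \<in> O[at 0](\<lambda>h. h ^ Suc (Suc p))"
    using exact_series[OF y k, of "Suc p"] landau_o.big.uminus_in_iff[of "\<lambda>h. y (tn + h) k - series exact_weight (Suc p) h k"]
    by (simp only: minus_diff_eq)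
  from bigo_power_mono[OF this, of "Suc p"]
  have ex: "(\<lambda>h. series exact_weight (Suc p) h k - y (tn + h) k) \<in> O[at 0](\<lambda>h. h ^ Suc p)" by (simp del: power_Suc)
  have "(\<lambda>h. h ^ tree_order t * (W (forget t) - exact_weight (forget t)) * elem_diff t k) \<in> O[at 0](\<lambda>h. h ^ Suc p)" for t
  proof (cases "tree_order t \<le> p")
    case True
    then show ?thesis using weights[OF forget_in_LW1] by (simp add: W_def)
  next
    case False
    then show ?thesis by (intro monomial_bigo) simp
  qed
  then have "(\<lambda>h. \<Sum>t\<in>trees (Suc p). h ^ tree_order t * (W (forget t) - exact_weight (forget t)) * elem_diff t k)
      \<in> O[at 0](\<lambda>h. h ^ Suc p)"
    by (rule big_sum_in_bigo)
  moreover have "(\<Sum>t\<in>trees (Suc p). h ^ tree_order t * (W (forget t) - exact_weight (forget t)) * elem_diff t k) =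
      series W (Suc p) h k - series exact_weight (Suc p) h k" for h
    by (simp add: series_def left_diff_distrib right_diff_distrib sum_subtractf del: trees.simps)
  ultimately have "(\<lambda>h. series W (Suc p) h k - series exact_weight (Suc p) h k) \<in> O[at 0](\<lambda>h. h ^ Suc p)"
    by (simp only:)
  from bigo_trans_diff[OF bigo_trans_diff[OF num this] ex] show ?thesis by (simp only: Suc_eq_plus1)
qed

end

section \<open>Polynomial systems that isolate a single weight\<close>

definition monomial :: "real \<Rightarrow> nat multiset \<Rightarrow> (nat \<Rightarrow> real) \<Rightarrow> real" where
  "monomial C M x = C * (\<Prod>i\<in>#M. x i)"

lemma monomial_upd:
  "(\<Prod>j\<in>#M. (x(i := t)) j :: real) = t ^ count M i * (\<Prod>j\<in>#filter_mset (\<lambda>j. j \<noteq> i) M. x j)"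
  by (induction M) auto

text \<open>
  Monomials times constants are closed under partial derivatives, which is why they are smooth.
\<close>

lemma monomial_has_partial:
  "((\<lambda>t. monomial C M (x(i := t))) has_real_derivative
     monomial (C * count M i) (M - {#i#}) x) (at (x i))"
proof -
  let ?R = "\<Prod>j\<in>#filter_mset (\<lambda>j. j \<noteq> i) M. x j"
  have "filter_mset (\<lambda>j. j \<noteq> i) (M - {#i#}) = filter_mset (\<lambda>j. j \<noteq> i) M"
    by (rule multiset_eqI) simp
  then have "(\<Prod>j\<in>#M - {#i#}. x j) = x i ^ (count M i - Suc 0) * ?R"
    using monomial_upd[of x i "x i" "M - {#i#}"] by simp
  moreover have "((\<lambda>t. C * (t ^ count M i * ?R)) has_real_derivative
      C * ((real (count M i) * x i ^ (count M i - Suc 0)) * ?R)) (at (x i))"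
    by (intro DERIV_cmult DERIV_cmult_right DERIV_pow)
  ultimately show ?thesis
    unfolding monomial_def monomial_upd by (simp add: mult_ac)
qed

lemma partial_monomial:
  "partial i (monomial C M) = monomial (C * count M i) (M - {#i#})"
  using DERIV_imp_deriv[OF monomial_has_partial] by (simp add: partial_def fun_eq_iff)

lemma continuous_map_monomial:
  "continuous_map (Euclidean_space N) euclideanreal (monomial C M)"
proof (induction M)
  case empty
  then show ?case by (simp add: monomial_def[abs_def])
next
  case (add i M)
  have "continuous_map (Euclidean_space N) euclideanreal (\<lambda>x. x i)"
    unfolding Euclidean_space_def
    by (intro continuous_map_from_subtopology continuous_map_product_projection) simp
  from continuous_map_real_mult[OF this add] show ?case
    by (simp add: monomial_def[abs_def] mult_ac)
qed

lemma smooth_fun_monomial: "smooth_fun N (monomial C M)"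
proof -
  have "\<exists>C' M'. foldr partial is (monomial C M) = monomial C' M'" for "is"
    by (induction "is") (auto, metis partial_monomial)
  then show ?thesis unfolding smooth_fun_def
    by (metis continuous_map_monomial monomial_has_partial field_differentiable_def)
qed

lemma higher_deriv_monomial:
  "\<exists>c' q'. (deriv ^^ m) (\<lambda>t::real. c * t ^ q) = (\<lambda>t. c' * t ^ q')"
proof (induction m)
  case (Suc m)
  then obtain c' q' where "(deriv ^^ m) (\<lambda>t. c * t ^ q) = (\<lambda>t. c' * t ^ q')" by auto
  moreover have "deriv (\<lambda>t. c' * t ^ q') = (\<lambda>t. (c' * q') * t ^ (q' - Suc 0))"
    by (intro ext DERIV_imp_deriv) (auto intro!: derivative_eq_intros)
  ultimately show ?case by auto
qed auto

definition chain_length :: "ltree \<Rightarrow> nat" where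
  "chain_length \<tau> = (THE q. \<exists>ts. \<tau> = \<theta> q ts)"

definition chain_top :: "ltree \<Rightarrow> ltree multiset" where
  "chain_top \<tau> = (THE ts. \<exists>q. \<tau> = \<theta> q ts)"

lemma chain_length_\<theta> [simp]: "chain_length (\<theta> q ts) = q"
  and chain_top_\<theta> [simp]: "chain_top (\<theta> q ts) = ts"
  by (auto simp: chain_length_def chain_top_def \<theta>_inject)

lemma root_kind_\<theta> [simp]: "root_kind (\<theta> q ts) \<noteq> Meagre"
  by (metis \<theta>_not_Meagre ltree.collapse)

text \<open>
  The elements of such a set, restricted to \<open>LW1\<close>, become the coordinates of the system for \<open>\<tau>\<close>; equal
  subtrees share a coordinate.
\<close>

lemma ex_finite_subtree_closed:
  "\<exists>S. finite S \<and> \<tau> \<in> S \<and> (\<forall>c ts. Vertex c ts \<in> S \<longrightarrow> set_mset ts \<subseteq> S)"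
proof (induction \<tau>)
  case (Vertex c ts)
  then obtain S where S: "\<And>\<sigma>. \<sigma> \<in># ts \<Longrightarrow> finite (S \<sigma>)" "\<And>\<sigma>. \<sigma> \<in># ts \<Longrightarrow> \<sigma> \<in> S \<sigma>"
    "\<And>\<sigma> c us. \<sigma> \<in># ts \<Longrightarrow> Vertex c us \<in> S \<sigma> \<Longrightarrow> set_mset us \<subseteq> S \<sigma>" by metis
  then have "finite (insert (Vertex c ts) (\<Union>\<sigma>\<in>set_mset ts. S \<sigma>))" by auto
  moreover have "\<forall>d us. Vertex d us \<in> insert (Vertex c ts) (\<Union>\<sigma>\<in>set_mset ts. S \<sigma>) \<longrightarrow>
      set_mset us \<subseteq> insert (Vertex c ts) (\<Union>\<sigma>\<in>set_mset ts. S \<sigma>)"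
    using S(2,3) by fastforce
  ultimately show ?case by blast
qed

lemma LW1_subtrees: "Vertex c ts \<in> LW1 \<Longrightarrow> set_mset ts \<subseteq> LW1"
  by (auto elim: LW1.cases)

text \<open>
  An enumeration \<open>node 1, \<dots>, node m\<close> of a set of trees that contains the subtrees occurring in the
  recursion for the weights. The coordinates of the system are the indices \<open>1, \<dots>, m\<close>; the index \<open>0\<close>
  is kept for the constant coordinate, which stands for the missing subtree of a fat leaf.
\<close>

locale tree_system =
  fixes m :: nat and node :: "nat \<Rightarrow> ltree" and idx :: "ltree \<Rightarrow> nat"
  assumes idx_node: "k \<in> {1..m} \<Longrightarrow> idx (node k) = k"
    and node_LW1: "k \<in> {1..m} \<Longrightarrow> node k \<in> LW1"
    and closed_Meagre: "k \<in> {1..m} \<Longrightarrow> node k = Vertex Meagre ts \<Longrightarrow> \<sigma> \<in># ts \<Longrightarrow>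
      idx \<sigma> \<in> {1..m} \<and> node (idx \<sigma>) = \<sigma>"
    and closed_\<theta>: "k \<in> {1..m} \<Longrightarrow> node k = \<theta> q ts \<Longrightarrow> \<sigma> \<in># ts \<Longrightarrow>
      idx \<sigma> \<in> {1..m} \<and> node (idx \<sigma>) = \<sigma>"
begin

definition sys_F :: "(nat \<Rightarrow> real) \<Rightarrow> nat \<Rightarrow> real" where
  "sys_F x k = (if k \<in> {1..m} \<and> root_kind (node k) = Meagre
     then \<Prod>\<sigma>\<in>#subtrees (node k). x (idx \<sigma>) else 0)"

text \<open>
  The coordinate read by the matrix row of a chain: its subtree, or the constant coordinate.
\<close>

definition target :: "ltree multiset \<Rightarrow> nat" where
  "target ts = (if ts = {#} then 0 else idx (the_elem (set_mset ts)))"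

definition sys_L :: "real \<Rightarrow> nat \<Rightarrow> nat \<Rightarrow> real" where
  "sys_L t k l = (if k \<in> {1..m} \<and> root_kind (node k) \<noteq> Meagre \<and> l = target (chain_top (node k))
     then t ^ chain_length (node k) else 0)"

text \<open>
  The stages, the step and the solution of the system all have this form, each with its own \<open>w\<close>.
\<close>

definition weight_vec :: "(ltree \<Rightarrow> real) \<Rightarrow> real \<Rightarrow> nat \<Rightarrow> real" where
  "weight_vec w h k = (if k = 0 then 1 else if k \<in> {1..m} then h ^ \<rho> (node k) * w (node k) else 0)"

lemma weight_vec_RN: "weight_vec w h \<in> RN (Suc m)"
  by (simp add: RN_iff weight_vec_def)

lemma weight_vec_0: "weight_vec w 0 = weight_vec w' 0"
proof
  have "(0::real) ^ \<rho> \<tau> = 0" for \<tau> using \<rho>_pos[of \<tau>] by simp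
  then show "weight_vec w 0 k = weight_vec w' 0 k" for k by (simp add: weight_vec_def)
qed

lemma weight_vec_idx: "idx \<sigma> \<in> {1..m} \<Longrightarrow> node (idx \<sigma>) = \<sigma> \<Longrightarrow> weight_vec w h (idx \<sigma>) = h ^ \<rho> \<sigma> * w \<sigma>"
  by (simp add: weight_vec_def)

lemma prod_power_weight:
  "(\<Prod>\<sigma>\<in>#ts. h ^ \<rho> \<sigma> * w \<sigma> :: real) = h ^ (\<Sum>\<sigma>\<in>#ts. \<rho> \<sigma>) * (\<Prod>\<sigma>\<in>#ts. w \<sigma>)"
  by (induction ts) (simp_all add: power_add)

lemma sys_F_Meagre:
  assumes "k \<in> {1..m}" "node k = Vertex Meagre ts"
  shows "sys_F (weight_vec w h) k = h ^ (\<Sum>\<sigma>\<in>#ts. \<rho> \<sigma>) * (\<Prod>\<sigma>\<in>#ts. w \<sigma>)"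
proof -
  have "(\<Prod>\<sigma>\<in>#ts. weight_vec w h (idx \<sigma>)) = (\<Prod>\<sigma>\<in>#ts. h ^ \<rho> \<sigma> * w \<sigma>)"
    using closed_Meagre[OF assms] by (intro arg_cong[of _ _ prod_mset] image_mset_cong) (simp add: weight_vec_idx)
  then show ?thesis using assms by (simp add: sys_F_def prod_power_weight)
qed

lemma sys_F_\<theta>: "node k = \<theta> q ts \<Longrightarrow> sys_F x k = 0"
  by (simp add: sys_F_def)

lemma target_le:
  assumes "k \<in> {1..m}" "root_kind (node k) \<noteq> Meagre"
  shows "target (chain_top (node k)) \<le> m"
  using node_LW1[OF assms(1)]
proof (cases rule: LW1_cases)
  case (theta q \<tau>1)
  then show ?thesis using closed_\<theta>[OF assms(1), of q "{#\<tau>1#}" \<tau>1] by (simp add: target_def)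
qed (use assms in \<open>auto simp: target_def\<close>)

lemma mat_vec_sys_L:
  "mat_vec (Suc m) (sys_L t) x k = (if k \<in> {1..m} \<and> root_kind (node k) \<noteq> Meagre
     then t ^ chain_length (node k) * x (target (chain_top (node k))) else 0)"
proof (cases "k \<in> {1..m} \<and> root_kind (node k) \<noteq> Meagre")
  case True
  then have "(\<Sum>l<Suc m. sys_L t k l * x l) = (\<Sum>l<Suc m. if l = target (chain_top (node k))
      then t ^ chain_length (node k) * x l else 0)"
    by (intro sum.cong) (auto simp: sys_L_def)
  then show ?thesis using True target_le[of k] by (simp add: mat_vec_def less_Suc_eq_le del: sum.lessThan_Suc)
next
  case False
  then show ?thesis by (auto simp: mat_vec_def sys_L_def intro!: sum.neutral)
qed

lemma mat_vec_Meagre: "node k = Vertex Meagre ts \<Longrightarrow> mat_vec (Suc m) (sys_L t) x k = 0"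
  by (simp add: mat_vec_sys_L)

lemma mat_vec_\<theta>:
  assumes k: "k \<in> {1..m}" and nk: "node k = \<theta> q ts"
  shows "mat_vec (Suc m) (sys_L t) (weight_vec w h) k = t ^ q * (h ^ (\<Sum>\<sigma>\<in>#ts. \<rho> \<sigma>) * (\<Prod>\<sigma>\<in>#ts. w \<sigma>))"
proof -
  have "weight_vec w h (target ts) = h ^ (\<Sum>\<sigma>\<in>#ts. \<rho> \<sigma>) * (\<Prod>\<sigma>\<in>#ts. w \<sigma>)"
    using node_LW1[OF k]
  proof (cases rule: LW1_cases)
    case (Meagre us)
    with nk \<theta>_not_Meagre show ?thesis by metis
  next
    case (theta_leaf r)
    with nk show ?thesis by (simp add: \<theta>_inject target_def weight_vec_def)
  next
    case (theta r \<tau>1)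
    with nk have "ts = {#\<tau>1#}" by (simp add: \<theta>_inject)
    then show ?thesis using closed_\<theta>[OF k nk, of \<tau>1] by (simp add: target_def weight_vec_idx)
  qed
  then show ?thesis using assms by (simp add: mat_vec_sys_L)
qed

lemma sys_outside:
  assumes "k \<notin> {1..m}"
  shows "sys_F x k = 0" "mat_vec (Suc m) (sys_L t) x k = 0"
  using assms by (auto simp: sys_F_def mat_vec_sys_L)

lemma smooth_field_sys_F: "smooth_field (Suc m) sys_F"
  unfolding smooth_field_def
proof (intro conjI allI impI)
  show "sys_F \<in> RN (Suc m) \<rightarrow> RN (Suc m)"
    by (auto simp: RN_iff sys_F_def)
  fix k
  have "(\<lambda>x. sys_F x k) = (if k \<in> {1..m} \<and> root_kind (node k) = Meagre
      then monomial 1 (image_mset idx (subtrees (node k))) else monomial 0 {#})"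
    by (auto simp: sys_F_def monomial_def fun_eq_iff image_mset.compositionality comp_def)
  then show "smooth_fun (Suc m) (\<lambda>x. sys_F x k)" by (simp add: smooth_fun_monomial)
qed

lemma smooth_matrix_sys_L: "smooth_matrix N sys_L"
  unfolding smooth_matrix_def
proof (intro allI impI)
  fix k l n t
  obtain c q where "(\<lambda>t. sys_L t k l) = (\<lambda>t. c * t ^ q)"
  proof (cases "k \<in> {1..m} \<and> root_kind (node k) \<noteq> Meagre \<and> l = target (chain_top (node k))")
    case True
    then show ?thesis using that[of 1 "chain_length (node k)"] by (simp add: sys_L_def)
  next
    case False
    then show ?thesis using that[of 0 0] by (auto simp: sys_L_def fun_eq_iff)
  qed
  then obtain c' q' where "(deriv ^^ n) (\<lambda>t. sys_L t k l) = (\<lambda>t. c' * t ^ q')"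
    using higher_deriv_monomial by metis
  moreover have "((\<lambda>t. c' * t ^ q') has_real_derivative c' * (real q' * t ^ (q' - Suc 0))) (at t)"
    by (intro DERIV_cmult DERIV_pow)
  ultimately show "(deriv ^^ n) (\<lambda>t. sys_L t k l) field_differentiable at t"
    by (auto simp: field_differentiable_def)
qed

text \<open>
  The right-hand side is exact because each row of the system is a single monomial in the
  coordinates of the children: the powers of \<open>h\<close> of the children and of \<open>h * \<gamma> j\<close> add up to one less
  than the number of vertices, and the coefficients multiply as in the recursion for the weights.
\<close>

lemma weight_vec_rk:
  assumes C_Meagre: "\<And>ts. C (Vertex Meagre ts) = (\<Sum>j\<in>J. \<alpha> j * (\<Prod>\<tau>\<in>#ts. c j \<tau>))"
    and C_\<theta>: "\<And>q ts. C (\<theta> q ts) = (\<Sum>j\<in>J. \<beta> j * \<gamma> j ^ q * (\<Prod>\<tau>\<in>#ts. c j \<tau>))"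
  shows "weight_vec C h k = weight_vec C 0 k + h * (\<Sum>j\<in>J. \<alpha> j * sys_F (weight_vec (c j) h) k) +
    h * (\<Sum>j\<in>J. \<beta> j * mat_vec (Suc m) (sys_L (h * \<gamma> j)) (weight_vec (c j) h) k)"
proof (cases "k \<in> {1..m}")
  case False
  then show ?thesis by (auto simp: sys_outside weight_vec_def)
next
  case k: True
  have "(0::real) ^ \<rho> (node k) = 0" using \<rho>_pos[of "node k"] by simp
  then have v0: "weight_vec C 0 k = 0" and v: "weight_vec C h k = h ^ \<rho> (node k) * C (node k)"
    using k by (auto simp: weight_vec_def)
  have "(\<exists>ts. node k = Vertex Meagre ts) \<or> (\<exists>q ts. node k = \<theta> q ts)"
    using node_LW1[OF k] by (cases rule: LW1_cases) auto
  then show ?thesis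
  proof (elim disjE exE)
    fix ts assume nk: "node k = Vertex Meagre ts"
    show ?thesis
      unfolding v v0 unfolding nk sys_F_Meagre[OF k nk] mat_vec_Meagre[OF nk] C_Meagre
      by (simp add: sum_distrib_left mult_ac)
  next
    fix q ts assume nk: "node k = \<theta> q ts"
    show ?thesis
      unfolding v v0 unfolding nk sys_F_\<theta>[OF nk] mat_vec_\<theta>[OF k nk] C_\<theta>
      by (simp add: sum_distrib_left \<rho>_\<theta> power_add power_mult_distrib mult_ac)
  qed
qed

text \<open>
  A meagre coordinate integrates the product of its children, which is the recursion for
  \<open>exact_weight\<close>. The coordinate of a chain has derivative zero, since only the matrix acts on it.
\<close>

lemma local_solution_weight_vec: "local_solution (Suc m) sys_F 0 (weight_vec w 0) (weight_vec exact_weight)"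
  unfolding local_solution_def
proof (intro conjI always_eventually allI impI)
  show "weight_vec exact_weight 0 = weight_vec w 0" by (rule weight_vec_0)
  show "weight_vec exact_weight t \<in> RN (Suc m)" for t by (rule weight_vec_RN)
  fix t k
  show "((\<lambda>t. weight_vec exact_weight t k) has_real_derivative sys_F (weight_vec exact_weight t) k) (at t)"
  proof (cases "k \<in> {1..m}")
    case False
    then show ?thesis by (auto simp: sys_outside weight_vec_def)
  next
    case k: True
    then have v: "weight_vec exact_weight t k = t ^ \<rho> (node k) * exact_weight (node k)" for t
      by (simp add: weight_vec_def)
    have "(\<exists>ts. node k = Vertex Meagre ts) \<or> (\<exists>q ts. node k = \<theta> q ts)"
      using node_LW1[OF k] by (cases rule: LW1_cases) auto
    then show ?thesis
    proof (elim disjE exE)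
      fix ts assume nk: "node k = Vertex Meagre ts"
      have "((\<lambda>t. t ^ \<rho> (Vertex Meagre ts) * exact_weight (Vertex Meagre ts)) has_real_derivative
          real (\<rho> (Vertex Meagre ts)) * t ^ (\<rho> (Vertex Meagre ts) - Suc 0) * exact_weight (Vertex Meagre ts)) (at t)"
        by (intro DERIV_cmult_right DERIV_pow)
      moreover have "real (\<rho> (Vertex Meagre ts)) * t ^ (\<rho> (Vertex Meagre ts) - Suc 0) * exact_weight (Vertex Meagre ts) =
          t ^ (\<Sum>\<sigma>\<in>#ts. \<rho> \<sigma>) * (\<Prod>\<sigma>\<in>#ts. exact_weight \<sigma>)"
        unfolding exact_weight_Meagre[symmetric] by simp
      ultimately show ?thesis
        unfolding v unfolding nk sys_F_Meagre[OF k nk] by (simp only:)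
    next
      fix q ts assume nk: "node k = \<theta> q ts"
      show ?thesis unfolding v unfolding nk sys_F_\<theta>[OF nk] exact_weight_\<theta> by simp
    qed
  qed
qed

text \<open>
  The curves with weights \<open>Phi_bar\<close> satisfy the stage equations for every \<open>h\<close>, so the error of the step
  at the coordinate of a tree is exactly \<open>h ^ \<rho> \<tau>\<close> times the defect in the condition for that tree.
\<close>

lemma weight_if_order:
  assumes a: "\<And>i j. i \<in> {1..s} \<Longrightarrow> j \<in> {1..s} \<Longrightarrow> j \<ge> i \<Longrightarrow> a i j = 0"
    and \<gamma>: "\<And>i j. i \<in> {1..s} \<Longrightarrow> j \<in> {1..s} \<Longrightarrow> j > i \<Longrightarrow> \<gamma> i j = 0"
    and order: "lirkw1_order s a \<gamma> b g p"
    and k: "k \<in> {1..m}" "\<rho> (node k) \<le> p"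
  shows "(\<Sum>j=1..s. Phi s a \<gamma> b g (node k) j) = exact_weight (node k)"
proof -
  define W where "W \<tau> = (\<Sum>j=1..s. Phi s a \<gamma> b g \<tau> j)" for \<tau>
  define P where "P i \<tau> = Phi_bar s a \<gamma> \<tau> i" for i \<tau>
  let ?yn = "weight_vec W 0"
  have "lirkw1_step s a \<gamma> b g (Suc m) sys_F sys_L 0 ?yn h (weight_vec W h)" for h
    unfolding lirkw1_step_def
  proof (intro exI[of _ "\<lambda>i. weight_vec (P i) h"] conjI ballI allI)
    show "weight_vec (P i) h \<in> RN (Suc m)" for i by (rule weight_vec_RN)
    show "weight_vec W h k = ?yn k + h * (\<Sum>i=1..s. b i * sys_F (weight_vec (P i) h) k) +
        h * (\<Sum>i=1..s. g i * mat_vec (Suc m) (sys_L (0 + h * \<gamma> i i)) (weight_vec (P i) h) k)" for k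
      unfolding add_0 by (rule weight_vec_rk) (simp_all add: W_def P_def)
    fix i k assume i: "i \<in> {1..s}"
    have "(\<Sum>j=1..<i. a i j * sys_F (weight_vec (P j) h) k) = (\<Sum>j=1..s. a i j * sys_F (weight_vec (P j) h) k)"
      using i a by (intro sum.mono_neutral_left) auto
    moreover have "(\<Sum>j=1..i. \<gamma> i j * mat_vec (Suc m) (sys_L (0 + h * \<gamma> j j)) (weight_vec (P j) h) k) =
        (\<Sum>j=1..s. \<gamma> i j * mat_vec (Suc m) (sys_L (h * \<gamma> j j)) (weight_vec (P j) h) k)"
      unfolding add_0 using i \<gamma> by (intro sum.mono_neutral_left) auto
    moreover have "weight_vec (P i) h k = weight_vec (P i) 0 k + h * (\<Sum>j=1..s. a i j * sys_F (weight_vec (P j) h) k) +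
        h * (\<Sum>j=1..s. \<gamma> i j * mat_vec (Suc m) (sys_L (h * \<gamma> j j)) (weight_vec (P j) h) k)"
      by (rule weight_vec_rk) (simp_all add: P_def)
    ultimately show "weight_vec (P i) h k = ?yn k + h * (\<Sum>j=1..<i. a i j * sys_F (weight_vec (P j) h) k) +
        h * (\<Sum>j=1..i. \<gamma> i j * mat_vec (Suc m) (sys_L (0 + h * \<gamma> j j)) (weight_vec (P j) h) k)"
      using weight_vec_0[of "P i" W] by (simp only:)
  qed
  then have "\<forall>\<^sub>F h in at 0. lirkw1_step s a \<gamma> b g (Suc m) sys_F sys_L 0 ?yn h (weight_vec W h)" by simp
  then have "\<forall>k<Suc m. (\<lambda>h. weight_vec W h k - weight_vec exact_weight (0 + h) k) \<in> O[at 0](\<lambda>h. h ^ (p + 1))"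
    using order smooth_field_sys_F smooth_matrix_sys_L weight_vec_RN local_solution_weight_vec
    unfolding lirkw1_order_def by blast
  then have "(\<lambda>h. weight_vec W h k - weight_vec exact_weight (0 + h) k) \<in> O[at 0](\<lambda>h. h ^ (p + 1))"
    using k(1) by auto
  then have "(\<lambda>h. weight_vec W h k - weight_vec exact_weight (0 + h) k) \<in> O[at 0](\<lambda>h. h ^ (p + 1))"
    using k(1) by auto
  then have "(\<lambda>h. weight_vec W h k - weight_vec exact_weight (0 + h) k) \<in> O[at 0](\<lambda>h. h ^ (p + 1))"
    using k(1) by auto
  then have "(\<lambda>h. weight_vec W h k - weight_vec exact_weight (0 + h) k) \<in> O[at 0](\<lambda>h. h ^ (p + 1))"
    using k(1) by auto
  then have "(\<lambda>h. weight_vec W h k - weight_vec exact_weight (0 + h) k) \<in> O[at 0](\<lambda>h. h ^ (p + 1))"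
    using k(1) by auto
  moreover have "weight_vec W h k - weight_vec exact_weight (0 + h) k = h ^ \<rho> (node k) * (W (node k) - exact_weight (node k))" for h
    using k by (simp add: weight_vec_def right_diff_distrib)
  ultimately have "(\<lambda>h. h ^ \<rho> (node k) * (W (node k) - exact_weight (node k))) \<in> O[at 0](\<lambda>h. h ^ (p + 1))"
    by (simp only:)
  from bigo_higher_power_imp_zero[OF this k(2)] show ?thesis by (simp add: W_def)
qed

end

lemma ex_tree_system:
  assumes "\<tau> \<in> LW1"
  obtains m node idx k where "tree_system m node idx" "k \<in> {1..m}" "node k = \<tau>"
proof -
  obtain S0 where S0: "finite S0" "\<tau> \<in> S0" "\<And>c ts. Vertex c ts \<in> S0 \<Longrightarrow> set_mset ts \<subseteq> S0"
    using ex_finite_subtree_closed by metis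
  define S where "S = S0 \<inter> LW1"
  have fin: "finite S" and \<tau>S: "\<tau> \<in> S" using S0 assms by (auto simp: S_def)
  have closed: "set_mset ts \<subseteq> S" if "Vertex c ts \<in> S" for c ts
    using that S0(3)[of c ts] LW1_subtrees[of c ts] by (auto simp: S_def)
  have closed_\<theta>: "set_mset ts \<subseteq> S" if "\<theta> q ts \<in> S" for q ts
    using that
  proof (induction q)
    case 0
    then show ?case by (simp add: \<theta>_0 closed)
  next
    case (Suc q)
    then show ?case using closed[of Square "{#\<theta> q ts#}"] by (simp add: \<theta>_Suc)
  qed
  obtain node where node: "bij_betw node {1..card S} S"
    using ex_bij_betw_nat_finite_1[OF fin] by auto
  define idx where "idx = inv_into {1..card S} node"
  have node_idx: "idx \<sigma> \<in> {1..card S} \<and> node (idx \<sigma>) = \<sigma>" if "\<sigma> \<in> S" for \<sigma>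
    using that node unfolding idx_def bij_betw_def by (metis f_inv_into_f inv_into_into)
  have "tree_system (card S) node idx"
  proof
    fix k assume k: "k \<in> {1..card S}"
    then have kS: "node k \<in> S" using node by (auto simp: bij_betw_def)
    then show "node k \<in> LW1" by (simp add: S_def)
    show "idx (node k) = k" using k node by (simp add: idx_def bij_betw_def)
    show "idx \<sigma> \<in> {1..card S} \<and> node (idx \<sigma>) = \<sigma>" if "node k = Vertex Meagre ts" "\<sigma> \<in># ts" for ts \<sigma>
      using closed[of Meagre ts] kS that node_idx by auto
    show "idx \<sigma> \<in> {1..card S} \<and> node (idx \<sigma>) = \<sigma>" if "node k = \<theta> q ts" "\<sigma> \<in># ts" for q ts \<sigma>
      using closed_\<theta>[of q ts] kS that node_idx by auto
  qed
  then show thesis using that node_idx[OF \<tau>S] by blast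
qed

section \<open>The order conditions\<close>

lemma T_subset_LW1: "\<tau> \<in> T \<Longrightarrow> \<tau> \<in> LW1"
  by (induction rule: T.induct) (auto intro: LW1.intros)

theorem theorem3p1:
  fixes s p :: nat
    and a \<gamma> :: "nat \<Rightarrow> nat \<Rightarrow> real"
    and b g :: "nat \<Rightarrow> real"
  assumes "p \<ge> 1"
    and "\<And>i j. i \<in> {1..s} \<Longrightarrow> j \<in> {1..s} \<Longrightarrow> j \<ge> i \<Longrightarrow> a i j = 0"
    and "\<And>i j. i \<in> {1..s} \<Longrightarrow> j \<in> {1..s} \<Longrightarrow> j > i \<Longrightarrow> \<gamma> i j = 0"
  shows "lirkw1_order s a \<gamma> b g p \<longleftrightarrow>
    (\<forall>\<tau>\<in>T. \<rho> \<tau> \<le> p \<longrightarrow> (\<Sum>j=1..s. Phi s a \<gamma> b g \<tau> j) = 1 / real (tree_density \<tau>)) \<and>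
    (\<forall>\<tau>\<in>LW1 - T. \<rho> \<tau> \<le> p \<longrightarrow> (\<Sum>j=1..s. Phi s a \<gamma> b g \<tau> j) = 0)"
proof -
  have "lirkw1_order s a \<gamma> b g p \<longleftrightarrow>
      (\<forall>\<tau>\<in>LW1. \<rho> \<tau> \<le> p \<longrightarrow> (\<Sum>j=1..s. Phi s a \<gamma> b g \<tau> j) = exact_weight \<tau>)"
  proof (intro iffI ballI impI)
    fix \<tau> assume *: "lirkw1_order s a \<gamma> b g p" "\<tau> \<in> LW1" "\<rho> \<tau> \<le> p"
    obtain m node idx k where sys: "tree_system m node idx" and k: "k \<in> {1..m}" "node k = \<tau>"
      using ex_tree_system[OF \<open>\<tau> \<in> LW1\<close>] by metis
    show "(\<Sum>j=1..s. Phi s a \<gamma> b g \<tau> j) = exact_weight \<tau>"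
      using tree_system.weight_if_order[OF sys assms(2,3) *(1) k(1)] * k(2) by simp
  next
    assume *: "\<forall>\<tau>\<in>LW1. \<rho> \<tau> \<le> p \<longrightarrow> (\<Sum>j=1..s. Phi s a \<gamma> b g \<tau> j) = exact_weight \<tau>"
    show "lirkw1_order s a \<gamma> b g p"
      unfolding lirkw1_order_def
    proof (intro allI impI)
      fix N F L tn yn y \<eta> k
      assume "smooth_field N F" "smooth_matrix N L" "yn \<in> RN N"
      then interpret smooth_data N F L tn yn by unfold_locales
      assume "local_solution N F tn yn y"
        "\<forall>\<^sub>F h in at 0. lirkw1_step s a \<gamma> b g N F L tn yn h (\<eta> h)" "k < N"
      then show "(\<lambda>h. \<eta> h k - y (tn + h) k) \<in> O[at 0](\<lambda>h. h ^ (p + 1))"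
        using * by (intro local_error_bigo[OF assms(2,3)]) auto
    qed
  qed
  also have "\<dots> \<longleftrightarrow>
    (\<forall>\<tau>\<in>T. \<rho> \<tau> \<le> p \<longrightarrow> (\<Sum>j=1..s. Phi s a \<gamma> b g \<tau> j) = 1 / real (tree_density \<tau>)) \<and>
    (\<forall>\<tau>\<in>LW1 - T. \<rho> \<tau> \<le> p \<longrightarrow> (\<Sum>j=1..s. Phi s a \<gamma> b g \<tau> j) = 0)"
    using T_subset_LW1 unfolding exact_weight_def by (smt (verit) Diff_iff)
  finally show ?thesis .
qed

end
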